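(* Let $(\mathcal{X}_{\mathrm{free}}, \mathbf{x}_{\mathrm{init}}, \mathbf{x}_{\mathrm{goal}})$ be a $\delta$-robustly feasible path planning problem in dimension $d$ (for some $\delta>0$), with optimal path $\sigma^*$ of cost $c^*$. Let $\eta\ge 0$, and for each $n$ let $c_n$ be the cost of the path returned by BFMT$^*$ run with $n$ samples and connection radius $$r_n = 4\,(1+\eta)^{1/d}\left(\frac1d\right)^{1/d}\left(\frac{\mu(\mathcal{X}_{\mathrm{free}})}{\zeta_d}\right)^{1/d}\left(\frac{\log n}{n}\right)^{1/d}.$$ Then BFMT$^*$ converges in probability to the optimum as $n\to\infty$; specifically, for every $\epsilon>0$, $$\lim_{n\to\infty}\mathbb{P}\big(c_n>(1+\epsilon)\,c^*\big)=0.$$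
   Context: **Path planning problem.** $\mathcal{X}\subset\mathbb{R}^d$ is a $d$-dimensional configuration space and $\mathcal{X}_{\mathrm{obs}}$ is the obstacle region, with $\mathcal{X}\setminus\mathcal{X}_{\mathrm{obs}}$ open and $\partial\mathcal{X}\subset\mathcal{X}_{\mathrm{obs}}$. The free space is $\mathcal{X}_{\mathrm{free}}=\mathrm{cl}(\mathcal{X}\setminus\mathcal{X}_{\mathrm{obs}})$ (closure). $\mu$ is Lebesgue measure, $0<\mu(\mathcal{X}_{\mathrm{free}})<\infty$, and $\zeta_d$ is the volume of the $d$-dimensional Euclidean unit ball. A problem is a triple $(\mathcal{X}_{\mathrm{free}},\mathbf{x}_{\mathrm{init}},\mathbf{x}_{\mathrm{goal}})$ with initial and goal configurations $\mathbf{x}_{\mathrm{init}},\mathbf{x}_{\mathrm{goal}}$. A path is a continuous function $\sigma:[0,1]\to\mathcal{X}$ of bounded variation. It is collision-free if $\sigma(\tau)\in\mathcal{X}_{\mathrm{free}}$ for all $\tau$, and feasible if it is collision-free with $\sigma(0)=\mathbf{x}_{\mathrm{init}}$ and $\sigma(1)=\mathbf{x}_{\mathrm{goal}}$. The cost $c(\sigma)$ is the Euclidean arc length of $\sigma$. An optimal path $\sigma^*$ is a feasible path with $c(\sigma^* )=c^*=\min\{c(\sigma):\sigma\text{ feasible}\}$. The $\delta$-interior of $\mathcal{X}_{\mathrm{free}}$ is the set of its points at distance at least $\delta$ from every point of $\mathcal{X}_{\mathrm{obs}}$. A collision-free path has strong $\delta$-clearance if it lies entirely in the $\delta$-interior of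 $\mathcal{X}_{\mathrm{free}}$. A problem with optimal path cost $c^*$ is $\delta$-robustly feasible if there exist a strictly positive sequence $\delta_n\to0$ with $\delta_n\le\delta$ for all $n\in\mathbb{N}$ and a sequence $\{\sigma_n\}_{n\ge1}$ of feasible paths such that $\lim_{n\to\infty}c(\sigma_n)=c^*$ and, for all $n$, $\sigma_n$ has strong $\delta_n$-clearance, $\sigma_n(0)=\mathbf{x}_{\mathrm{init}}$, $\sigma_n(1)=\mathbf{x}_{\mathrm{goal}}$, and $\sigma_n(\tau)\ne\mathbf{x}_{\mathrm{goal}}$ for all $\tau\in(0,1)$. **Notation for the algorithm.** A tree is a quadruple $T=(V,E,V_{\mathrm{unvisited}},V_{\mathrm{open}})$ (nodes, edges, unvisited samples, wavefront nodes). $\mathrm{Cost}(\mathbf{x},T)$ is the length of the unique path in $T$ from its root to $\mathbf{x}$, and $\mathrm{Path}(\mathbf{x},T)$ is that path. $\mathrm{Near}(A,\mathbf{z},r)=\{\mathbf{x}\in A:\|\mathbf{x}-\mathbf{z}\|<r\}$. $\mathrm{CollisionFree}(\mathbf{x},\mathbf{y})$ means the straight segment from $\mathbf{x}$ to $\mathbf{y}$ lies in $\mathcal{X}_{\mathrm{free}}$. Ties in minimizations are broken arbitrarily. **Algorithm BFMT$^*$** (inputs $\mathbf{x}_{\mathrm{init}},\mathbf{x}_{\mathrm{goal}},r_n,n$). If $\mathbf{x}_{\mathrm{init}}=\mathbf{x}_{\mathrm{goal}}$, return the trivial path of cost $0$. Otherwise: 1. Let $S=\{\mathbf{x}_{\mathrm{init}},\mathbf{x}_{\mathrm{goal}}\}\cup\{n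 \text{ i.i.d. uniform samples from }\mathcal{X}_{\mathrm{free}}\}$. Initialize $T$ with root $\mathbf{x}_{\mathrm{init}}$ and $T'$ with root $\mathbf{x}_{\mathrm{goal}}$. A tree initialized with root $\mathbf{x}_0$ has $V=V_{\mathrm{open}}=\{\mathbf{x}_0\}$, $E=\emptyset$, $V_{\mathrm{unvisited}}=S\setminus\{\mathbf{x}_0\}$. Set $\mathbf{z}=\mathbf{x}_{\mathrm{init}}$; the meeting node $\mathbf{x}_{\mathrm{meet}}$ is undefined (its cost is taken to be $\infty$). Repeat steps 2–5. 2. *Expand* $T$ from $\mathbf{z}$: let $Z=\mathrm{Near}(V_{\mathrm{unvisited}},\mathbf{z},r_n)$ and $V_{\mathrm{new}}=\emptyset$. For each $\mathbf{x}\in Z$, let $\mathbf{x}_{\min}$ minimize $\mathrm{Cost}(\tilde{\mathbf{x}},T)+\|\tilde{\mathbf{x}}-\mathbf{x}\|$ over $\tilde{\mathbf{x}}\in\mathrm{Near}(V_{\mathrm{open}},\mathbf{x},r_n)$. If $\mathrm{CollisionFree}(\mathbf{x}_{\min},\mathbf{x})$, then add $\mathbf{x}$ to $V$ and to $V_{\mathrm{new}}$, add edge $(\mathbf{x}_{\min},\mathbf{x})$ to $E$, and remove $\mathbf{x}$ from $V_{\mathrm{unvisited}}$; moreover, if $\mathbf{x}\in V'$ (the node set of $T'$) and $\mathrm{Cost}(\mathbf{x},T)+\mathrm{Cost}(\mathbf{x},T')<\mathrm{Cost}(\mathbf{x}_{\mathrm{meet}},T)+\mathrm{Cost}(\mathbf{x}_{\mathrm{meet}},T')$,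 set $\mathbf{x}_{\mathrm{meet}}=\mathbf{x}$. (If the segment is not collision-free, $\mathbf{x}$ is skipped and stays unvisited.) After the loop over $Z$, set $V_{\mathrm{open}}=(V_{\mathrm{open}}\cup V_{\mathrm{new}})\setminus\{\mathbf{z}\}$. 3. If $\mathbf{x}_{\mathrm{meet}}$ is defined, stop and return the concatenation of $\mathrm{Path}(\mathbf{x}_{\mathrm{meet}},T)$ and $\mathrm{Path}(\mathbf{x}_{\mathrm{meet}},T')$, of cost $\mathrm{Cost}(\mathbf{x}_{\mathrm{meet}},T)+\mathrm{Cost}(\mathbf{x}_{\mathrm{meet}},T')$. 4. Otherwise, if the wavefront $V'_{\mathrm{open}}$ of $T'$ is empty, *Insert* a new sample in $T'$: repeatedly draw fresh independent uniform samples $\mathbf{s}$ from $\mathcal{X}_{\mathrm{free}}$ until some $\mathbf{s}$ has at least one node $\mathbf{x}\in\mathrm{Near}(V',\mathbf{s},r_n)$ with $\mathrm{CollisionFree}(\mathbf{x},\mathbf{s})$. Among such $\mathbf{x}$, connect $\mathbf{s}$ to the one minimizing $\mathrm{Cost}(\mathbf{x},T')+\|\mathbf{x}-\mathbf{s}\|$, adding $\mathbf{s}$ to $V'$ and $V'_{\mathrm{open}}$ and the corresponding edge to $E'$. 5. Let $\mathbf{z}$ minimize $\mathrm{Cost}(\cdot,T')$ over $V'_{\mathrm{open}}$, then swap the roles of $T$ and $T'$. The algorithm is run to completion, i.e. there is no external early termination. If no path is ever returned, $c_n=\infty$. *)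

theory Defs
  imports "HOL-Probability.Probability"
begin

section \<open>Path planning problems\<close>

definition free_space :: "'a::euclidean_space set \<Rightarrow> 'a set \<Rightarrow> 'a set" where
  "free_space X Xobs = closure (X - Xobs)"

definition polyline_length :: "'a::metric_space list \<Rightarrow> real" where
  "polyline_length p = (\<Sum>i<length p - 1. dist (p ! i) (p ! Suc i))"

text \<open>The supremum of the lengths of inscribed polylines, i.e. the total variation on the unit
  interval; it is infinite exactly when the function is not of bounded variation.\<close>

definition arc_length :: "(real \<Rightarrow> 'a::metric_space) \<Rightarrow> ereal" where
  "arc_length \<sigma> =
     (SUP ts \<in> {ts. sorted ts \<and> set ts \<subseteq> {0..1}}. ereal (polyline_length (map \<sigma> ts)))"

definition is_path :: "'a::euclidean_space set \<Rightarrow> (real \<Rightarrow> 'a) \<Rightarrow> bool" where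
  "is_path X \<sigma> \<longleftrightarrow> continuous_on {0..1} \<sigma> \<and> \<sigma> ` {0..1} \<subseteq> X \<and> arc_length \<sigma> < \<infinity>"

definition collision_free_path ::
  "'a::euclidean_space set \<Rightarrow> 'a set \<Rightarrow> (real \<Rightarrow> 'a) \<Rightarrow> bool" where
  "collision_free_path X Xobs \<sigma> \<longleftrightarrow> is_path X \<sigma> \<and> \<sigma> ` {0..1} \<subseteq> free_space X Xobs"

definition feasible_path ::
  "'a::euclidean_space set \<Rightarrow> 'a set \<Rightarrow> 'a \<Rightarrow> 'a \<Rightarrow> (real \<Rightarrow> 'a) \<Rightarrow> bool" where
  "feasible_path X Xobs xinit xgoal \<sigma> \<longleftrightarrow>
     collision_free_path X Xobs \<sigma> \<and> \<sigma> 0 = xinit \<and> \<sigma> 1 = xgoal"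

definition optimal_path ::
  "'a::euclidean_space set \<Rightarrow> 'a set \<Rightarrow> 'a \<Rightarrow> 'a \<Rightarrow> (real \<Rightarrow> 'a) \<Rightarrow> bool" where
  "optimal_path X Xobs xinit xgoal \<sigma> \<longleftrightarrow>
     feasible_path X Xobs xinit xgoal \<sigma> \<and>
     (\<forall>\<tau>. feasible_path X Xobs xinit xgoal \<tau> \<longrightarrow> arc_length \<sigma> \<le> arc_length \<tau>)"

definition delta_interior :: "'a::euclidean_space set \<Rightarrow> 'a set \<Rightarrow> real \<Rightarrow> 'a set" where
  "delta_interior X Xobs \<delta> = {x \<in> free_space X Xobs. \<forall>y\<in>Xobs. \<delta> \<le> dist x y}"

definition strong_clearance ::
  "'a::euclidean_space set \<Rightarrow> 'a set \<Rightarrow> real \<Rightarrow> (real \<Rightarrow> 'a) \<Rightarrow> bool" where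
  "strong_clearance X Xobs \<delta> \<sigma> \<longleftrightarrow>
     collision_free_path X Xobs \<sigma> \<and> \<sigma> ` {0..1} \<subseteq> delta_interior X Xobs \<delta>"

definition robustly_feasible ::
  "'a::euclidean_space set \<Rightarrow> 'a set \<Rightarrow> 'a \<Rightarrow> 'a \<Rightarrow> real \<Rightarrow> bool" where
  "robustly_feasible X Xobs xinit xgoal \<delta> \<longleftrightarrow>
     (\<exists>\<sigma>opt (\<delta>s :: nat \<Rightarrow> real) \<sigma>s.
        optimal_path X Xobs xinit xgoal \<sigma>opt \<and>
        (\<forall>n\<ge>1. 0 < \<delta>s n \<and> \<delta>s n \<le> \<delta>) \<and> \<delta>s \<longlonglongrightarrow> 0 \<and>
        (\<lambda>n. arc_length (\<sigma>s n)) \<longlonglongrightarrow> arc_length \<sigma>opt \<and>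
        (\<forall>n\<ge>1. feasible_path X Xobs xinit xgoal (\<sigma>s n) \<and>
                strong_clearance X Xobs (\<delta>s n) (\<sigma>s n) \<and>
                (\<forall>t\<in>{0<..<1}. \<sigma>s n t \<noteq> xgoal)))"


section \<open>Search trees\<close>

text \<open>Edges are directed from parent to child, so a path from the root to a node follows the
  direction of the edges.\<close>

record 'a search_tree =
  root :: 'a
  nodes :: "'a set"
  edges :: "('a \<times> 'a) set"
  unvisited :: "'a set"
  wavefront :: "'a set"

definition init_tree :: "'a set \<Rightarrow> 'a \<Rightarrow> 'a search_tree" where
  "init_tree S x0 =
     \<lparr>root = x0, nodes = {x0}, edges = {}, unvisited = S - {x0}, wavefront = {x0}\<rparr>"

definition tree_path :: "'a search_tree \<Rightarrow> 'a \<Rightarrow> 'a list" where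
  "tree_path T x = (THE p. p \<noteq> [] \<and> hd p = root T \<and> last p = x \<and> distinct p \<and>
                           successively (\<lambda>u v. (u, v) \<in> edges T) p)"

definition tree_cost :: "'a::metric_space search_tree \<Rightarrow> 'a \<Rightarrow> real" where
  "tree_cost T x = polyline_length (tree_path T x)"

definition near :: "'a::euclidean_space set \<Rightarrow> 'a \<Rightarrow> real \<Rightarrow> 'a set" where
  "near A z r = {x \<in> A. norm (x - z) < r}"

definition collision_free :: "'a::euclidean_space set \<Rightarrow> 'a \<Rightarrow> 'a \<Rightarrow> bool" where
  "collision_free F x y \<longleftrightarrow> closed_segment x y \<subseteq> F"


section \<open>The algorithm\<close>

text \<open>Throughout, \<open>F\<close> is the free space and \<open>r\<close> the connection radius. The algorithm is a
  transition relation rather than a function: a minimiser is any point satisfying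
  \<^const>\<open>is_arg_min\<close>, and the samples in a neighbourhood may be processed in any order.
  \<open>None\<close> stands for an undefined meeting node.\<close>

fun meet_cost ::
  "'a::euclidean_space search_tree \<Rightarrow> 'a search_tree \<Rightarrow> 'a option \<Rightarrow> ereal" where
  "meet_cost T T' None = \<infinity>"
| "meet_cost T T' (Some m) = ereal (tree_cost T m + tree_cost T' m)"

definition best_parent ::
  "'a::euclidean_space search_tree \<Rightarrow> 'a set \<Rightarrow> 'a \<Rightarrow> 'a \<Rightarrow> bool" where
  "best_parent T A x p \<longleftrightarrow> is_arg_min (\<lambda>y. tree_cost T y + norm (y - x)) (\<lambda>y. y \<in> A) p"

definition visit :: "'a search_tree \<Rightarrow> 'a \<Rightarrow> 'a \<Rightarrow> 'a search_tree" where
  "visit T p x = T\<lparr>nodes := insert x (nodes T), edges := insert (p, x) (edges T),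
                   unvisited := unvisited T - {x}\<rparr>"

definition update_meet ::
  "'a::euclidean_space search_tree \<Rightarrow> 'a search_tree \<Rightarrow> 'a \<Rightarrow> 'a option \<Rightarrow> 'a option" where
  "update_meet T T' x m =
     (if x \<in> nodes T' \<and> ereal (tree_cost T x + tree_cost T' x) < meet_cost T T' m
      then Some x else m)"

text \<open>\<open>expand_loop F r T' xs T N m T1 N1 m1\<close>: processing the samples \<open>xs\<close> in order turns the
  tree \<open>T\<close>, the set \<open>N\<close> of new nodes and the meeting node \<open>m\<close> into \<open>T1\<close>, \<open>N1\<close> and \<open>m1\<close>.\<close>

inductive expand_loop ::
  "'a::euclidean_space set \<Rightarrow> real \<Rightarrow> 'a search_tree \<Rightarrow> 'a list \<Rightarrow>
   'a search_tree \<Rightarrow> 'a set \<Rightarrow> 'a option \<Rightarrow> 'a search_tree \<Rightarrow> 'a set \<Rightarrow> 'a option \<Rightarrow> bool"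
  for F r T' where
  finish: "expand_loop F r T' [] T N m T N m"
| connect: "\<lbrakk>best_parent T (near (wavefront T) x r) x p; collision_free F p x;
             expand_loop F r T' xs (visit T p x) (insert x N)
               (update_meet (visit T p x) T' x m) T1 N1 m1\<rbrakk>
            \<Longrightarrow> expand_loop F r T' (x # xs) T N m T1 N1 m1"
| skip: "\<lbrakk>best_parent T (near (wavefront T) x r) x p; \<not> collision_free F p x;
          expand_loop F r T' xs T N m T1 N1 m1\<rbrakk>
         \<Longrightarrow> expand_loop F r T' (x # xs) T N m T1 N1 m1"

definition expand ::
  "'a::euclidean_space set \<Rightarrow> real \<Rightarrow> 'a \<Rightarrow> 'a search_tree \<Rightarrow> 'a search_tree \<Rightarrow> 'a option \<Rightarrow>
   'a search_tree \<Rightarrow> 'a option \<Rightarrow> bool" where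
  "expand F r z T T' m T1 m1 \<longleftrightarrow>
     (\<exists>xs T0 N. set xs = near (unvisited T) z r \<and> distinct xs \<and>
        expand_loop F r T' xs T {} m T0 N m1 \<and>
        T1 = T0\<lparr>wavefront := (wavefront T0 \<union> N) - {z}\<rparr>)"

definition connectable ::
  "'a::euclidean_space set \<Rightarrow> real \<Rightarrow> 'a search_tree \<Rightarrow> 'a \<Rightarrow> 'a set" where
  "connectable F r T s = {x \<in> near (nodes T) s r. collision_free F x s}"

text \<open>The random draws are consumed from a sequence \<open>\<xi>\<close>, of which the first \<open>k\<close> have been used
  before and the first \<open>k'\<close> after the insertion.\<close>

definition insert_sample ::
  "'a::euclidean_space set \<Rightarrow> real \<Rightarrow> (nat \<Rightarrow> 'a) \<Rightarrow> 'a search_tree \<Rightarrow> nat \<Rightarrow>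
   'a search_tree \<Rightarrow> nat \<Rightarrow> bool" where
  "insert_sample F r \<xi> T k T1 k' \<longleftrightarrow>
     (\<exists>j\<ge>k. \<exists>p. connectable F r T (\<xi> j) \<noteq> {} \<and>
        (\<forall>i. k \<le> i \<and> i < j \<longrightarrow> connectable F r T (\<xi> i) = {}) \<and>
        best_parent T (connectable F r T (\<xi> j)) (\<xi> j) p \<and>
        T1 = T\<lparr>nodes := insert (\<xi> j) (nodes T), edges := insert (p, \<xi> j) (edges T),
               wavefront := insert (\<xi> j) (wavefront T)\<rparr> \<and>
        k' = Suc j)"

text \<open>\<open>Running T T' z k\<close> is the state at the start of an iteration, in which \<open>T\<close> is about to be
  expanded from \<open>z\<close>; \<open>Returned l\<close> means that a path of cost \<open>l\<close> has been returned.\<close>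

datatype 'a bfmt_state =
  Running "'a search_tree" "'a search_tree" 'a nat
| Returned real

inductive bfmt_step ::
  "'a::euclidean_space set \<Rightarrow> real \<Rightarrow> (nat \<Rightarrow> 'a) \<Rightarrow> 'a bfmt_state \<Rightarrow> 'a bfmt_state \<Rightarrow> bool"
  for F r \<xi> where
  stop: "expand F r z T T' None T1 (Some m)
         \<Longrightarrow> bfmt_step F r \<xi> (Running T T' z k) (Returned (tree_cost T1 m + tree_cost T' m))"
| proceed: "\<lbrakk>expand F r z T T' None T1 None;
          if wavefront T' = {} then insert_sample F r \<xi> T' k T2 k' else T2 = T' \<and> k' = k;
          is_arg_min (tree_cost T2) (\<lambda>y. y \<in> wavefront T2) z'\<rbrakk>
         \<Longrightarrow> bfmt_step F r \<xi> (Running T T' z k) (Running T2 T1 z' k')"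

definition bfmt_init :: "'a \<Rightarrow> 'a \<Rightarrow> nat \<Rightarrow> (nat \<Rightarrow> 'a) \<Rightarrow> 'a bfmt_state" where
  "bfmt_init xinit xgoal n \<xi> =
     (let S = {xinit, xgoal} \<union> \<xi> ` {..<n}
      in Running (init_tree S xinit) (init_tree S xgoal) xinit n)"

text \<open>A maximal execution; it is constant from the first state without successor on. Such a state
  is either \<^const>\<open>Returned\<close> or one in which the insertion loop draws samples forever.\<close>

definition bfmt_execution ::
  "'a::euclidean_space set \<Rightarrow> 'a \<Rightarrow> 'a \<Rightarrow> real \<Rightarrow> nat \<Rightarrow> (nat \<Rightarrow> 'a) \<Rightarrow>
   (nat \<Rightarrow> 'a bfmt_state) \<Rightarrow> bool" where
  "bfmt_execution F xinit xgoal r n \<xi> s \<longleftrightarrow>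
     s 0 = bfmt_init xinit xgoal n \<xi> \<and>
     (\<forall>i. if \<exists>t. bfmt_step F r \<xi> (s i) t then bfmt_step F r \<xi> (s i) (s (Suc i))
          else s (Suc i) = s i)"

text \<open>\<open>c\<close> is a possible cost of the returned path, for some way of breaking ties, when the
  algorithm is run with \<open>n\<close> samples and the sequence \<open>\<xi>\<close> of random draws; the cost is infinite
  if the execution never returns a path.\<close>

definition bfmt_cost ::
  "'a::euclidean_space set \<Rightarrow> 'a \<Rightarrow> 'a \<Rightarrow> real \<Rightarrow> nat \<Rightarrow> (nat \<Rightarrow> 'a) \<Rightarrow> ereal \<Rightarrow> bool" where
  "bfmt_cost F xinit xgoal r n \<xi> c \<longleftrightarrow>
     (if xinit = xgoal then c = 0
      else \<exists>s. bfmt_execution F xinit xgoal r n \<xi> s \<and>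
             ((\<exists>i l. s i = Returned l \<and> c = ereal l) \<or>
              (\<forall>i l. s i \<noteq> Returned l) \<and> c = \<infinity>))"

lemma ex_bfmt_cost: "\<exists>c. bfmt_cost F xinit xgoal r n \<xi> c"
proof -
  define next_state where "next_state = (\<lambda>s. if \<exists>t. bfmt_step F r \<xi> s t
    then SOME t. bfmt_step F r \<xi> s t else s)"
  define s where "s = (\<lambda>i. (next_state ^^ i) (bfmt_init xinit xgoal n \<xi>))"
  have "bfmt_execution F xinit xgoal r n \<xi> s"
    by (auto simp: bfmt_execution_def s_def next_state_def intro: someI)
  then show ?thesis
    unfolding bfmt_cost_def by metis
qed

definition bfmt_radius :: "'a::euclidean_space set \<Rightarrow> real \<Rightarrow> nat \<Rightarrow> real" where
  "bfmt_radius F \<eta> n =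
     (let d = real DIM('a); \<mu> = measure lborel F; \<zeta> = measure lborel (cball (0::'a) 1)
      in 4 * (1 + \<eta>) powr (1 / d) * (1 / d) powr (1 / d) * (\<mu> / \<zeta>) powr (1 / d) *
         (ln (real n) / real n) powr (1 / d))"

end

theory Submission
  imports Defs "HOL-Real_Asymp.Real_Asymp"
begin

text \<open>Fix a feasible path with positive clearance whose length \<open>l\<close> is close to the optimum, and
  cut it into pieces of chordal length \<open>r / 4\<close>, where \<open>r\<close> is the connection radius. Every cut
  point has a sample within \<open>r / 4\<close> with probability tending to 1 by a union bound (this is where
  the constant 4 of the radius is used), and all but a fraction \<open>\<beta>\<close> of them have one within
  \<open>\<beta> * r\<close> by Markov's inequality. So the samples contain a chain of waypoints of length at most
  about \<open>(1 + 10 * \<beta>) * l\<close> whose neighbourhoods of radius \<open>r\<close> are obstacle-free, so that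
  connections to waypoints never fail.

  Given such a chain, in each tree a visited waypoint costs at most the part of the chain leading to
  it. As long as the trees have not met, each wavefront contains a waypoint; hence no sample is ever
  inserted, the expanded node costs at most as much as that waypoint, and the trees meet at a total
  cost of at most the length of the chain plus \<open>2 * r\<close>.\<close>

subsection \<open>Paths and costs in search trees\<close>

lemma polyline_length_snoc:
  assumes "p \<noteq> []"
  shows "polyline_length (p @ [x]) = polyline_length p + dist (last p) x"
proof -
  obtain k where k: "length p = Suc k"
    using assms by (cases p) auto
  have "(\<Sum>i<k. dist ((p @ [x]) ! i) ((p @ [x]) ! Suc i)) = (\<Sum>i<k. dist (p ! i) (p ! Suc i))"
    using k by (intro sum.cong) (auto simp: nth_append)
  then show ?thesis
    using k assms by (simp add: polyline_length_def nth_append last_conv_nth)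
qed

text \<open>Names the predicate under the definite description in \<open>tree_path\<close>, so that
  facts about costs reduce to existence and uniqueness of root paths.\<close>

definition root_path :: "'a search_tree \<Rightarrow> 'a \<Rightarrow> 'a list \<Rightarrow> bool" where
  "root_path T x p \<longleftrightarrow> p \<noteq> [] \<and> hd p = root T \<and> last p = x \<and> distinct p \<and>
     successively (\<lambda>u v. (u, v) \<in> edges T) p"

text \<open>Unique root paths encode being a tree without mentioning cycles, and they are exactly
  what makes \<open>tree_path\<close> and \<open>tree_cost\<close> meaningful.\<close>

definition wf_tree :: "'a search_tree \<Rightarrow> bool" where
  "wf_tree T \<longleftrightarrow> root T \<in> nodes T \<and> edges T \<subseteq> nodes T \<times> nodes T \<and>
     (\<forall>x\<in>nodes T. \<exists>!p. root_path T x p)"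

lemma tree_path_eq_The: "tree_path T x = (THE p. root_path T x p)"
  unfolding tree_path_def root_path_def ..

lemma tree_path_eqI:
  assumes "wf_tree T" "x \<in> nodes T" "root_path T x p"
  shows "tree_path T x = p"
proof -
  have "\<exists>!p. root_path T x p"
    using assms by (simp add: wf_tree_def)
  then show ?thesis
    unfolding tree_path_eq_The using assms(3) by (rule the1_equality)
qed

lemma root_path_tree_path:
  assumes "wf_tree T" "x \<in> nodes T"
  shows "root_path T x (tree_path T x)"
proof -
  have "\<exists>!p. root_path T x p"
    using assms by (simp add: wf_tree_def)
  then show ?thesis
    unfolding tree_path_eq_The by (rule theI')
qed

text \<open>Every element but the last is the source of an edge. The last one needs its own
  hypothesis, since a singleton list has no edge at all.\<close>

lemma successively_edges_nodes:
  assumes "edges T \<subseteq> nodes T \<times> nodes T" "successively (\<lambda>u v. (u, v) \<in> edges T) p"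
    and "p \<noteq> []" "last p \<in> nodes T"
  shows "set p \<subseteq> nodes T"
  using assms(2-)
proof (induction p rule: induct_list012)
  case (3 u v p)
  then show ?case
    using assms(1) by auto
qed auto

text \<open>No edge leads from the fresh node \<open>x\<close> back to an old node, so a path
  through the new edge could not end in \<open>nodes T\<close>.\<close>

lemma successively_visit_iff:
  assumes "edges T \<subseteq> nodes T \<times> nodes T" "x \<notin> nodes T" "q \<noteq> []" "last q \<in> nodes T"
  shows "successively (\<lambda>u v. (u, v) \<in> edges (visit T p x)) q \<longleftrightarrow>
         successively (\<lambda>u v. (u, v) \<in> edges T) q"
  using assms(3,4)
proof (induction q rule: induct_list012)
  case (3 u v q)
  have "v \<in> nodes T" if "successively (\<lambda>u v. (u, v) \<in> edges T) (v # q)"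
    using successively_edges_nodes[OF assms(1) that] 3 by auto
  then show ?case
    using 3 assms(2) by (auto simp: visit_def)
qed auto

lemma root_path_visit_old:
  assumes "wf_tree T" "x \<notin> nodes T" "y \<in> nodes T"
  shows "root_path (visit T p x) y q \<longleftrightarrow> root_path T y q"
proof -
  have "edges T \<subseteq> nodes T \<times> nodes T"
    using assms(1) by (simp add: wf_tree_def)
  from successively_visit_iff[OF this assms(2), of q p] show ?thesis
    using assms(3) by (auto simp: root_path_def visit_def)
qed

text \<open>The new edge is the only one into \<open>x\<close>, so a root path to \<open>x\<close>
  must arrive through \<open>p\<close>, and up to \<open>p\<close> it is a path of the old
  tree.\<close>

lemma root_path_visit_new:
  assumes "wf_tree T" "x \<notin> nodes T" "p \<in> nodes T"
  shows "root_path (visit T p x) x q \<longleftrightarrow> q = tree_path T p @ [x]"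
proof
  assume q: "root_path (visit T p x) x q"
  then obtain q' where q': "q = q' @ [x]"
    unfolding root_path_def by (metis append_butlast_last_id)
  \<comment> \<open>Otherwise \<open>x\<close> would be the root, which is an old node.\<close>
  have ne: "q' \<noteq> []"
    using q q' assms by (auto simp: root_path_def wf_tree_def visit_def)
  have "(last q', x) \<in> edges (visit T p x)"
    using q ne unfolding q' root_path_def by (auto simp: successively_append_iff)
  then have "last q' = p"
    using assms by (auto simp: visit_def wf_tree_def)
  then have "root_path (visit T p x) p q'"
    using q ne unfolding q' root_path_def by (auto simp: successively_append_iff visit_def)
  then show "q = tree_path T p @ [x]"
    using assms q' by (auto simp: root_path_visit_old dest: tree_path_eqI)
next
  assume q: "q = tree_path T p @ [x]"
  have p: "root_path T p (tree_path T p)"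
    by (rule root_path_tree_path[OF assms(1,3)])
  then have "root_path (visit T p x) p (tree_path T p)"
    using assms by (simp add: root_path_visit_old)
  moreover have "x \<notin> set (tree_path T p)"
    using successively_edges_nodes[of T "tree_path T p"] p assms
    unfolding root_path_def wf_tree_def by auto
  ultimately show "root_path (visit T p x) x q"
    unfolding q root_path_def by (auto simp: successively_append_iff visit_def)
qed

lemma wf_tree_visit:
  assumes "wf_tree T" "x \<notin> nodes T" "p \<in> nodes T"
  shows "wf_tree (visit T p x)"
proof -
  have "\<exists>!q. root_path (visit T p x) y q" if "y \<in> nodes T" for y
    using that assms(1) unfolding root_path_visit_old[OF assms(1,2) that] by (simp add: wf_tree_def)
  moreover have "\<exists>!q. root_path (visit T p x) x q"
    by (simp add: root_path_visit_new[OF assms])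
  moreover have "edges T \<subseteq> nodes T \<times> nodes T" "root T \<in> nodes T"
    using assms(1) by (simp_all add: wf_tree_def)
  ultimately show ?thesis
    using assms(3) by (auto simp: visit_def wf_tree_def)
qed

lemma tree_cost_visit_old:
  assumes "wf_tree T" "x \<notin> nodes T" "y \<in> nodes T"
  shows "tree_cost (visit T p x) y = tree_cost T y"
  by (simp add: tree_cost_def tree_path_eq_The root_path_visit_old[OF assms])

lemma tree_cost_visit_new:
  assumes "wf_tree T" "x \<notin> nodes T" "p \<in> nodes T"
  shows "tree_cost (visit T p x) x = tree_cost T p + norm (p - x)"
proof -
  have "tree_path (visit T p x) x = tree_path T p @ [x]"
    by (simp add: tree_path_eq_The[of "visit T p x"] root_path_visit_new[OF assms])
  moreover have "tree_path T p \<noteq> []" "last (tree_path T p) = p"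
    using root_path_tree_path[OF assms(1,3)] by (simp_all add: root_path_def)
  ultimately show ?thesis
    by (simp add: tree_cost_def polyline_length_snoc dist_norm)
qed

lemma wf_tree_init: "wf_tree (init_tree S x)"
  and tree_cost_init: "tree_cost (init_tree S x) x = 0"
proof -
  have *: "root_path (init_tree S x) x p \<longleftrightarrow> p = [x]" for p
    by (cases p; cases "tl p") (auto simp: root_path_def init_tree_def)
  then show "wf_tree (init_tree S x)"
    by (auto simp: wf_tree_def init_tree_def)
  have "tree_path (init_tree S x) x = [x]"
    by (simp add: tree_path_eq_The *)
  then show "tree_cost (init_tree S x) x = 0"
    by (simp add: tree_cost_def polyline_length_def)
qed

lemma wavefront_update [simp]:
  "tree_cost (T\<lparr>wavefront := W\<rparr>) = tree_cost T"
  "wf_tree (T\<lparr>wavefront := W\<rparr>) \<longleftrightarrow> wf_tree T"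
  by (simp_all add: tree_cost_def tree_path_def wf_tree_def root_path_def fun_eq_iff)

lemma visit_simps [simp]:
  "root (visit T p x) = root T" "nodes (visit T p x) = insert x (nodes T)"
  "unvisited (visit T p x) = unvisited T - {x}" "wavefront (visit T p x) = wavefront T"
  by (simp_all add: visit_def)

section \<open>The loop over the samples near the expanded node\<close>

lemma ex_best_parent:
  assumes "finite A" "A \<noteq> {}"
  shows "\<exists>p. best_parent T A x p"
  unfolding best_parent_def
  using ex_is_arg_min_if_finite[OF assms] by auto

lemma best_parentD:
  assumes "best_parent T A x p"
  shows "p \<in> A" "y \<in> A \<Longrightarrow> tree_cost T p + norm (p - x) \<le> tree_cost T y + norm (y - x)"
  using assms by (auto simp: best_parent_def is_arg_min_linorder)

text \<open>Since old costs never change, a parent chosen late in the loop can be described by the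
  costs at its beginning.\<close>

lemma best_parent_visit:
  assumes "wf_tree T" "x \<notin> nodes T" "A \<subseteq> nodes T"
  shows "best_parent (visit T p x) A y q \<longleftrightarrow> best_parent T A y q"
  using assms tree_cost_visit_old[of T x _ p]
  by (auto simp: best_parent_def is_arg_min_linorder subset_iff)

text \<open>\<open>A\<close> collects the samples that get connected. The wavefront is frozen during
  the loop and old costs are stable, so parents are described with respect to the initial tree
  \<open>T\<close>, whatever the order of the samples.\<close>

lemma expand_loop_result:
  assumes "expand_loop F r T' xs T N m T1 N1 m1"
    and "wf_tree T" "distinct xs" "set xs \<inter> nodes T = {}" "wavefront T \<subseteq> nodes T"
  shows "\<exists>A\<subseteq>set xs. nodes T1 = nodes T \<union> A \<and> N1 = N \<union> A \<and> unvisited T1 = unvisited T - A \<and>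
    root T1 = root T \<and> wavefront T1 = wavefront T \<and> wf_tree T1 \<and>
    (\<forall>y\<in>nodes T. tree_cost T1 y = tree_cost T y) \<and>
    (\<forall>x\<in>A. \<exists>p. best_parent T (near (wavefront T) x r) x p \<and>
            tree_cost T1 x = tree_cost T p + norm (p - x)) \<and>
    (\<forall>x\<in>set xs - A. \<exists>p. best_parent T (near (wavefront T) x r) x p \<and> \<not> collision_free F p x) \<and>
    (m1 = None \<longrightarrow> m = None \<and> A \<inter> nodes T' = {}) \<and>
    (\<forall>y. m1 = Some y \<longrightarrow> m = Some y \<or> y \<in> A \<inter> nodes T')"
  using assms
proof (induction rule: expand_loop.induct)
  case (finish T N m)
  then show ?case by auto
next
  case (connect T x p xs N m T1 N1 m1)
  have x: "x \<notin> nodes T" and sub: "near (wavefront T) y r \<subseteq> nodes T" for y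
    using connect.prems by (auto simp: near_def)
  have p: "p \<in> nodes T"
    using best_parentD(1)[OF connect.hyps(1)] sub by auto
  note cost = tree_cost_visit_old[OF \<open>wf_tree T\<close> x] tree_cost_visit_new[OF \<open>wf_tree T\<close> x p]
  have "distinct xs" "set xs \<inter> nodes (visit T p x) = {}"
      "wavefront (visit T p x) \<subseteq> nodes (visit T p x)"
    using connect.prems by auto
  from connect.IH[OF wf_tree_visit[OF \<open>wf_tree T\<close> x p] this]
  obtain A where A: "A \<subseteq> set xs" "nodes T1 = insert x (nodes T) \<union> A" "N1 = insert x N \<union> A"
      "unvisited T1 = unvisited T - {x} - A" "root T1 = root T" "wavefront T1 = wavefront T"
      "wf_tree T1" "\<forall>y\<in>insert x (nodes T). tree_cost T1 y = tree_cost (visit T p x) y"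
      "\<forall>y\<in>A. \<exists>q. best_parent T (near (wavefront T) y r) y q \<and>
            tree_cost T1 y = tree_cost (visit T p x) q + norm (q - y)"
      "\<forall>y\<in>set xs - A. \<exists>q. best_parent T (near (wavefront T) y r) y q \<and> \<not> collision_free F q y"
      "m1 = None \<longrightarrow> update_meet (visit T p x) T' x m = None \<and> A \<inter> nodes T' = {}"
      "\<forall>y. m1 = Some y \<longrightarrow> update_meet (visit T p x) T' x m = Some y \<or> y \<in> A \<inter> nodes T'"
    unfolding visit_simps best_parent_visit[OF \<open>wf_tree T\<close> x sub] by blast
  \<comment> \<open>An undefined meeting node costs infinity, so a sample that lies in the other
    tree always replaces it.\<close>
  have meet: "update_meet (visit T p x) T' x m = None \<longrightarrow> m = None \<and> x \<notin> nodes T'"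
    "\<forall>y. update_meet (visit T p x) T' x m = Some y \<longrightarrow> m = Some y \<or> y = x \<and> x \<in> nodes T'"
    by (auto simp: update_meet_def split: if_splits)
  show ?case
  proof (intro exI[of _ "insert x A"] conjI)
    show "\<forall>y\<in>insert x A. \<exists>q. best_parent T (near (wavefront T) y r) y q \<and>
            tree_cost T1 y = tree_cost T q + norm (q - y)"
      using A(8,9) connect.hyps(1) cost best_parentD(1) sub
      by (metis insert_iff subsetD)
    show "\<forall>y\<in>nodes T. tree_cost T1 y = tree_cost T y"
      using A(8) cost by simp
    show "\<forall>y\<in>set (x # xs) - insert x A. \<exists>q. best_parent T (near (wavefront T) y r) y q \<and>
            \<not> collision_free F q y"
      using A(10) by auto
    show "m1 = None \<longrightarrow> m = None \<and> insert x A \<inter> nodes T' = {}"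
      using A(11) meet(1) by blast
    show "\<forall>y. m1 = Some y \<longrightarrow> m = Some y \<or> y \<in> insert x A \<inter> nodes T'"
      using A(12) meet(2) by blast
  qed (use A(1-7) in auto)
next
  case (skip T x p xs N m T1 N1 m1)
  have "distinct xs" "set xs \<inter> nodes T = {}"
    using skip.prems by auto
  from skip.IH[OF \<open>wf_tree T\<close> this \<open>wavefront T \<subseteq> nodes T\<close>]
  obtain A where A: "A \<subseteq> set xs" "nodes T1 = nodes T \<union> A" "N1 = N \<union> A"
      "unvisited T1 = unvisited T - A" "root T1 = root T" "wavefront T1 = wavefront T"
      "wf_tree T1" "\<forall>y\<in>nodes T. tree_cost T1 y = tree_cost T y"
      "\<forall>x\<in>A. \<exists>p. best_parent T (near (wavefront T) x r) x p \<and>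
            tree_cost T1 x = tree_cost T p + norm (p - x)"
      "\<forall>x\<in>set xs - A. \<exists>p. best_parent T (near (wavefront T) x r) x p \<and> \<not> collision_free F p x"
      "m1 = None \<longrightarrow> m = None \<and> A \<inter> nodes T' = {}"
      "\<forall>y. m1 = Some y \<longrightarrow> m = Some y \<or> y \<in> A \<inter> nodes T'"
    by blast
  then show ?case
    using skip.hyps(1,2) by (intro exI[of _ A]) auto
qed

lemma ex_expand_loop:
  assumes "finite (wavefront T)" "\<And>x. x \<in> set xs \<Longrightarrow> near (wavefront T) x r \<noteq> {}"
  shows "\<exists>T1 N1 m1. expand_loop F r T' xs T N m T1 N1 m1"
  using assms
proof (induction xs arbitrary: T N m)
  case Nil
  then show ?case by (blast intro: finish)
next
  case (Cons x xs)
  have "finite (near (wavefront T) x r)"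
    using Cons.prems by (auto simp: near_def)
  then obtain p where p: "best_parent T (near (wavefront T) x r) x p"
    using ex_best_parent[of _ T x] Cons.prems by fastforce
  show ?case
  proof (cases "collision_free F p x")
    case True
    then show ?thesis
      using connect[OF p True] Cons.IH[of "visit T p x"] Cons.prems by fastforce
  next
    case False
    then show ?thesis
      using skip[OF p False] Cons.IH[of T] Cons.prems by fastforce
  qed
qed

subsection \<open>Executions along a chain of waypoints\<close>

definition chain_length :: "(nat \<Rightarrow> 'a::metric_space) \<Rightarrow> nat \<Rightarrow> real" where
  "chain_length w k = (\<Sum>i<k. dist (w i) (w (Suc i)))"

lemma chain_length_mono: "i \<le> j \<Longrightarrow> chain_length w i \<le> chain_length w j"
  unfolding chain_length_def by (intro sum_mono2) auto

lemma dist_le_chain_length: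
  "i \<le> j \<Longrightarrow> chain_length w i + dist (w i) (w j) \<le> chain_length w j"
proof (induction j rule: dec_induct)
  case (step j)
  then show ?case
    using dist_triangle[of "w i" "w (Suc j)" "w j"] by (simp add: chain_length_def)
qed simp

text \<open>The tree grown from the goal is measured along the reversed chain; this converts its
  bounds into lengths of the original chain.\<close>

lemma chain_length_rev:
  assumes "i \<le> m"
  shows "chain_length (\<lambda>i. w (m - i)) (m - i) = chain_length w m - chain_length w i"
proof -
  have "chain_length (\<lambda>i. w (m - i)) (m - i) = (\<Sum>j<m - i. dist (w (m - Suc j)) (w (m - j)))"
    unfolding chain_length_def by (simp add: dist_commute)
  also have "\<dots> = (\<Sum>j\<in>{i..<m}. dist (w j) (w (Suc j)))"
    by (rule sum.reindex_bij_witness[of _ "\<lambda>j. m - Suc j" "\<lambda>j. m - Suc j"])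
      (auto simp: Suc_diff_Suc)
  also have "\<dots> = chain_length w m - chain_length w i"
    using sum_diff_nat_ivl[of 0 i m "\<lambda>j. dist (w j) (w (Suc j))"] assms
    by (simp add: chain_length_def lessThan_atLeast0)
  finally show ?thesis .
qed

text \<open>The last condition ranges over all points \<open>p\<close> and not only over samples:
  whichever parent is selected for a waypoint, the single collision check made by the algorithm
  succeeds.\<close>

definition waypoints ::
  "'a::euclidean_space set \<Rightarrow> real \<Rightarrow> 'a set \<Rightarrow> (nat \<Rightarrow> 'a) \<Rightarrow> nat \<Rightarrow> bool" where
  "waypoints F r S w m \<longleftrightarrow> finite S \<and> w ` {..m} \<subseteq> S \<and>
     (\<forall>i<m. dist (w i) (w (Suc i)) < r) \<and>
     (\<forall>i\<le>m. \<forall>p. norm (p - w i) < r \<longrightarrow> collision_free F p (w i))"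

lemma waypoints_rev:
  assumes "waypoints F r S w m"
  shows "waypoints F r S (\<lambda>i. w (m - i)) m"
proof -
  have "dist (w (m - i)) (w (m - Suc i)) < r" if "i < m" for i
  proof -
    have "dist (w (m - Suc i)) (w (Suc (m - Suc i))) < r"
      using assms that by (auto simp: waypoints_def)
    then show ?thesis
      using that by (simp add: Suc_diff_Suc dist_commute)
  qed
  then show ?thesis
    using assms by (auto simp: waypoints_def)
qed

text \<open>The last condition holds because a node added while \<open>w i\<close> is unvisited is reached from the
  cheapest node of the wavefront, which contains a waypoint preceding \<open>w i\<close>. At the meeting node
  the conditions of the two trees add up to the length of the chain plus \<open>2 * r\<close>.\<close>

definition tracks :: "'a::euclidean_space set \<Rightarrow> real \<Rightarrow> (nat \<Rightarrow> 'a) \<Rightarrow> nat \<Rightarrow> 'a search_tree \<Rightarrow> bool"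
  where
  "tracks S r w m T \<longleftrightarrow>
     wf_tree T \<and> root T = w 0 \<and> nodes T \<subseteq> S \<and> unvisited T = S - nodes T \<and>
     wavefront T \<subseteq> nodes T \<and>
     (\<forall>i<m. w i \<in> nodes T - wavefront T \<longrightarrow> w (Suc i) \<in> nodes T) \<and>
     (\<forall>i\<le>m. w i \<in> nodes T \<longrightarrow> tree_cost T (w i) \<le> chain_length w i) \<and>
     (\<forall>x\<in>nodes T. \<forall>i\<le>m. w i \<notin> nodes T \<longrightarrow> tree_cost T x \<le> chain_length w i + r)"

text \<open>The trees swap roles in every iteration, so after two swaps the chain is reversed twice.
  With truncated subtraction this restores only the indices up to \<open>m\<close>, which are the
  ones that \<open>tracks\<close> looks at.\<close>

lemma tracks_rev_rev: "tracks S r (\<lambda>i. w (m - (m - i))) m T \<longleftrightarrow> tracks S r w m T"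
proof -
  have "chain_length (\<lambda>i. w (m - (m - i))) i = chain_length w i" if "i \<le> m" for i
    unfolding chain_length_def using that by (intro sum.cong) auto
  then show ?thesis
    unfolding tracks_def by (auto simp: less_imp_le Suc_leI)
qed

lemma tracks_root: "tracks S r w m T \<Longrightarrow> w 0 \<in> nodes T"
  by (metis tracks_def wf_tree_def)

lemma tracks_finite:
  assumes "waypoints F r S w m" "tracks S r w' m T"
  shows "finite (unvisited T)" "finite (wavefront T)"
proof -
  have "unvisited T \<subseteq> S" "wavefront T \<subseteq> S"
    using assms(2) by (auto simp: tracks_def)
  then show "finite (unvisited T)" "finite (wavefront T)"
    using assms(1) by (auto simp: waypoints_def intro: finite_subset)
qed

lemma tracks_init:
  assumes "waypoints F r S w m" "0 < r"
  shows "tracks S r w m (init_tree S (w 0))"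
proof -
  have "0 \<le> chain_length w i" for i
    by (auto simp: chain_length_def intro: sum_nonneg)
  moreover have "0 \<le> chain_length w i + r" for i
    using calculation[of i] assms(2) by simp
  ultimately show ?thesis
    using assms unfolding tracks_def
    by (auto simp: wf_tree_init tree_cost_init waypoints_def init_tree_def[of S "w 0"]
        tree_cost_init[unfolded init_tree_def] wf_tree_init[unfolded init_tree_def])
qed

text \<open>Take the predecessor of the first waypoint outside the tree: if it were no longer in the
  wavefront, the invariant would put its successor into the tree.\<close>

lemma tracks_frontier:
  assumes "tracks S r w m T" "k \<le> m" "w k \<notin> nodes T"
  obtains j where "j < k" "w j \<in> wavefront T" "tree_cost T (w j) \<le> chain_length w j"
proof -
  define i where "i = (LEAST i. w i \<notin> nodes T)"
  have i: "w i \<notin> nodes T" "i \<le> k"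
    unfolding i_def using LeastI[of "\<lambda>i. w i \<notin> nodes T"] assms(3) by (auto intro: Least_le)
  have "w 0 \<in> nodes T"
    using tracks_root[OF assms(1)] .
  with i(1) obtain j where j: "i = Suc j"
    by (cases i) auto
  then have "w j \<in> nodes T"
    using not_less_Least[of j "\<lambda>i. w i \<notin> nodes T"] i_def by auto
  then show thesis
    using assms i j by (intro that[of j]) (auto simp: tracks_def)
qed

text \<open>New nodes lie within \<open>r\<close> of \<open>z\<close>, the cheapest node of the
  wavefront, and connections to waypoints cannot fail. The cardinality drops because
  \<open>z\<close> is closed, while the connected samples only move from unvisited to the
  wavefront.\<close>

lemma expand_tracks:
  assumes "waypoints F r S w m" "tracks S r w m T"
    and "is_arg_min (tree_cost T) (\<lambda>y. y \<in> wavefront T) z"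
    and "expand F r z T T' None T1 m1"
  shows "tracks S r w m T1"
    and "\<And>x. x \<in> nodes T1 - nodes T \<Longrightarrow> tree_cost T1 x \<le> tree_cost T z + r"
    and "m1 = None \<Longrightarrow> nodes T1 \<inter> nodes T' \<subseteq> nodes T"
    and "\<And>x. m1 = Some x \<Longrightarrow> x \<in> nodes T' \<inter> nodes T1 - nodes T"
    and "card (unvisited T1 \<union> wavefront T1) < card (unvisited T \<union> wavefront T)"
proof -
  have T: "wf_tree T" "root T = w 0" "nodes T \<subseteq> S" "unvisited T = S - nodes T"
      "wavefront T \<subseteq> nodes T"
      "\<And>i. \<lbrakk>i < m; w i \<in> nodes T - wavefront T\<rbrakk> \<Longrightarrow> w (Suc i) \<in> nodes T"
      "\<And>i. \<lbrakk>i \<le> m; w i \<in> nodes T\<rbrakk> \<Longrightarrow> tree_cost T (w i) \<le> chain_length w i"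
      "\<And>x i. \<lbrakk>x \<in> nodes T; i \<le> m; w i \<notin> nodes T\<rbrakk> \<Longrightarrow> tree_cost T x \<le> chain_length w i + r"
    using assms(2) unfolding tracks_def by auto
  have W: "finite S" "\<And>i. i \<le> m \<Longrightarrow> w i \<in> S" "\<And>i. i < m \<Longrightarrow> dist (w i) (w (Suc i)) < r"
      "\<And>i p. i \<le> m \<Longrightarrow> norm (p - w i) < r \<Longrightarrow> collision_free F p (w i)"
    using assms(1) unfolding waypoints_def by auto
  have z: "z \<in> wavefront T" "\<And>y. y \<in> wavefront T \<Longrightarrow> tree_cost T z \<le> tree_cost T y"
    using assms(3) by (auto simp: is_arg_min_linorder)
  obtain xs T0 N where xs: "set xs = near (unvisited T) z r" "distinct xs"
      and loop: "expand_loop F r T' xs T {} None T0 N m1"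
      and T1: "T1 = T0\<lparr>wavefront := (wavefront T0 \<union> N) - {z}\<rparr>"
    using assms(4) unfolding expand_def by blast
  have disj: "set xs \<inter> nodes T = {}"
    using xs T(4) by (auto simp: near_def)
  obtain A where A: "A \<subseteq> set xs" "nodes T0 = nodes T \<union> A" "N = A"
      "unvisited T0 = unvisited T - A" "root T0 = root T" "wavefront T0 = wavefront T"
      "wf_tree T0" "\<And>y. y \<in> nodes T \<Longrightarrow> tree_cost T0 y = tree_cost T y"
      "\<And>x. x \<in> A \<Longrightarrow> \<exists>p. best_parent T (near (wavefront T) x r) x p \<and>
            tree_cost T0 x = tree_cost T p + norm (p - x)"
      "\<And>x. x \<in> set xs - A \<Longrightarrow>
            \<exists>p. best_parent T (near (wavefront T) x r) x p \<and> \<not> collision_free F p x"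
      "m1 = None \<Longrightarrow> A \<inter> nodes T' = {}"
      "\<And>y. m1 = Some y \<Longrightarrow> y \<in> A \<inter> nodes T'"
    using expand_loop_result[OF loop T(1) xs(2) disj T(5)] by auto
  have T1_simps: "nodes T1 = nodes T \<union> A" "wavefront T1 = (wavefront T \<union> A) - {z}"
      "unvisited T1 = unvisited T - A" "root T1 = w 0" "wf_tree T1" "tree_cost T1 = tree_cost T0"
    using A T(2) by (simp_all add: T1)
  have AS: "A \<subseteq> S - nodes T"
    using A(1) xs(1) T(4) by (auto simp: near_def)

  have near_z: "norm (z - x) < r" if "x \<in> A" for x
    using that A(1) xs(1) by (auto simp: near_def norm_minus_commute)
  have cost_le: "tree_cost T0 x \<le> tree_cost T y + norm (y - x)"
    if x: "x \<in> A" and y: "y \<in> wavefront T" "norm (y - x) < r" for x y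
    using A(9)[OF x] y by (auto simp: near_def dest: best_parentD(2))
  have new_cost: "tree_cost T0 x \<le> tree_cost T z + norm (z - x)" if "x \<in> A" for x
    using cost_le[OF that z(1) near_z[OF that]] .
  have new_cost': "tree_cost T0 x \<le> tree_cost T z + r" if "x \<in> A" for x
    using new_cost[OF that] near_z[OF that] by simp

  have connected: "w i \<in> nodes T \<union> A" if "i \<le> m" "norm (w i - z) < r" for i
  proof (rule ccontr)
    assume *: "w i \<notin> nodes T \<union> A"
    then have "w i \<in> set xs - A"
      using that W(2) T(4) xs(1) by (auto simp: near_def)
    then show False
      using A(10)[of "w i"] W(4)[OF that(1)] by (auto simp: near_def dest!: best_parentD(1))
  qed

  have waypoint_cost: "tree_cost T0 (w i) \<le> chain_length w i" if i: "i \<le> m" "w i \<in> A" for i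
  proof -
    have "w i \<notin> nodes T"
      using i AS by auto
    then obtain j where j: "j < i" "w j \<in> wavefront T" "tree_cost T (w j) \<le> chain_length w j"
      using tracks_frontier[OF assms(2) i(1)] by metis
    have d: "chain_length w j + dist (w j) (w i) \<le> chain_length w i"
      using dist_le_chain_length[of j i w] j(1) by simp
    show ?thesis
    \<comment> \<open>If \<open>w j\<close> is in reach, it competes as a parent of
      \<open>w i\<close>. Otherwise the chain needs at least \<open>r\<close> to get from
      \<open>w j\<close> to \<open>w i\<close>, which pays for the connection through
      \<open>z\<close>.\<close>
    proof (cases "norm (w j - w i) < r")
      case True
      then show ?thesis
        using cost_le[OF i(2) j(2) True] j(3) d by (simp add: dist_norm)
    next
      case False
      then show ?thesis
        using new_cost'[OF i(2)] z(2)[OF j(2)] j(3) d by (simp add: dist_norm)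
    qed
  qed

  show "tracks S r w m T1"
    unfolding tracks_def T1_simps
  proof (intro conjI allI impI ballI)
    fix i assume i: "i < m" "w i \<in> nodes T \<union> A - (wavefront T \<union> A - {z})"
    show "w (Suc i) \<in> nodes T \<union> A"
    \<comment> \<open>A waypoint closed now is either \<open>z\<close> itself, whose successor on
      the chain has just been connected, or was closed before.\<close>
    proof (cases "w i = z")
      case True
      then show ?thesis
        using connected[of "Suc i"] W(3)[OF i(1)] i(1) by (simp add: dist_norm norm_minus_commute)
    next
      case False
      then show ?thesis
        using T(6)[OF i(1)] i(2) by auto
    qed
  next
    fix i assume "i \<le> m" "w i \<in> nodes T \<union> A"
    then show "tree_cost T0 (w i) \<le> chain_length w i"
      using T(7) A(8) waypoint_cost by fastforce
  next
    fix x i assume x: "x \<in> nodes T \<union> A" and i: "i \<le> m" "w i \<notin> nodes T \<union> A"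
    show "tree_cost T0 x \<le> chain_length w i + r"
    proof (cases "x \<in> nodes T")
      case True
      then show ?thesis
        using T(8) A(8) i by simp
    next
      case False
      have "w i \<notin> nodes T"
        using i by simp
      then obtain j where j: "j < i" "w j \<in> wavefront T" "tree_cost T (w j) \<le> chain_length w j"
        using tracks_frontier[OF assms(2) i(1)] by metis
      then show ?thesis
        using new_cost'[of x] x False z(2)[OF j(2)] chain_length_mono[of j i w] by simp
    qed
  qed (use T AS A(7) z T1_simps(5) in auto)

  show "tree_cost T1 x \<le> tree_cost T z + r" if "x \<in> nodes T1 - nodes T" for x
    using that new_cost' by (auto simp: T1_simps)
  show "nodes T1 \<inter> nodes T' \<subseteq> nodes T" if "m1 = None"
    using A(11)[OF that] by (auto simp: T1_simps)
  show "x \<in> nodes T' \<inter> nodes T1 - nodes T" if "m1 = Some x" for x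
    using A(12)[OF that] AS by (auto simp: T1_simps)
  have "unvisited T1 \<union> wavefront T1 \<subset> unvisited T \<union> wavefront T"
    using z(1) T(4,5) AS by (auto simp: T1_simps)
  moreover have "finite (unvisited T \<union> wavefront T)"
    using tracks_finite[OF assms(1,2)] by simp
  ultimately show "card (unvisited T1 \<union> wavefront T1) < card (unvisited T \<union> wavefront T)"
    by (rule psubset_card_mono[rotated])
qed

lemma ex_expand:
  assumes "waypoints F r S w m" "tracks S r w m T" "z \<in> wavefront T"
  shows "\<exists>T1 m1. expand F r z T T' None T1 m1"
proof -
  note fin = tracks_finite[OF assms(1,2)]
  have "finite (near (unvisited T) z r)"
    using fin by (simp add: near_def)
  then obtain xs where xs: "set xs = near (unvisited T) z r" "distinct xs"
    using finite_distinct_list by metis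
  have "near (wavefront T) x r \<noteq> {}" if "x \<in> set xs" for x
  proof -
    have "z \<in> near (wavefront T) x r"
      using that assms(3) xs(1) by (auto simp: near_def norm_minus_commute)
    then show ?thesis by auto
  qed
  then show ?thesis
    using ex_expand_loop[OF fin(2), of xs r F T' "{}" None] xs unfolding expand_def by blast
qed

section \<open>Progress and termination of executions\<close>

inductive running_ok ::
  "'a::euclidean_space set \<Rightarrow> real \<Rightarrow> (nat \<Rightarrow> 'a) \<Rightarrow> nat \<Rightarrow> 'a bfmt_state \<Rightarrow> bool"
  for S r w m where
  "\<lbrakk>tracks S r w m T; tracks S r (\<lambda>i. w (m - i)) m T'; nodes T \<inter> nodes T' = {};
    is_arg_min (tree_cost T) (\<lambda>y. y \<in> wavefront T) z\<rbrakk>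
   \<Longrightarrow> running_ok S r w m (Running T T' z k)"

text \<open>A termination measure: every expansion closes one node for good, and no samples are
  inserted in the executions considered.\<close>

fun pending :: "'a bfmt_state \<Rightarrow> nat" where
  "pending (Running T T' z k) =
     card (unvisited T \<union> wavefront T) + card (unvisited T' \<union> wavefront T')"
| "pending (Returned l) = 0"

text \<open>The chain is reversed in the second alternative because the step swaps the two
  trees.\<close>

lemma running_ok_step:
  assumes "waypoints F r S w m" "0 < r" "running_ok S r w m s" "bfmt_step F r \<xi> s t"
  shows "(\<exists>l\<le>chain_length w m + 2 * r. t = Returned l) \<or>
         running_ok S r (\<lambda>i. w (m - i)) m t \<and> pending t < pending s"
  using assms(3)
proof cases
  case (1 T T' z k)
  let ?w' = "\<lambda>i. w (m - i)"
  have wm: "w m \<in> nodes T'"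
    using tracks_root[OF 1(3)] by simp
  have front: "w m \<notin> nodes T"
    using 1(4) wm by auto
  have "bfmt_step F r \<xi> (Running T T' z k) t"
    using assms(4) 1(1) by simp
  then show ?thesis
  proof cases
    case (stop T1 x)
    note E = expand_tracks[OF assms(1) 1(2,5) stop(2)]
    \<comment> \<open>This waypoint splits the chain for both bounds: the meeting node costs at most
      the part up to \<open>w j\<close> plus \<open>r\<close> in \<open>T1\<close>, and, as
      \<open>w j\<close> is missing from \<open>T'\<close>, at most the remaining part plus
      \<open>r\<close> in \<open>T'\<close>.\<close>
    obtain j where j: "j < m" "w j \<in> wavefront T" "tree_cost T (w j) \<le> chain_length w j"
      using tracks_frontier[OF 1(2) order_refl front] by metis
    have "tree_cost T z \<le> tree_cost T (w j)"
      using 1(5) j(2) by (auto simp: is_arg_min_linorder)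
    moreover have x: "x \<in> nodes T'" "tree_cost T1 x \<le> tree_cost T z + r"
      using E(2,4) by auto
    moreover have "w j \<notin> nodes T'"
      using 1(2,4) j(2) by (auto simp: tracks_def)
    then have "tree_cost T' x \<le> chain_length ?w' (m - j) + r"
      using 1(3) x(1) j(1) unfolding tracks_def
      by (metis diff_diff_cancel diff_le_self less_imp_le)
    ultimately have "tree_cost T1 x + tree_cost T' x \<le> chain_length w m + 2 * r"
      using j by (simp add: chain_length_rev)
    then show ?thesis
      using stop(1) by auto
  next
    case (proceed T1 T2 k' z')
    note E = expand_tracks[OF assms(1) 1(2,5) proceed(2)]
    have disj: "nodes T1 \<inter> nodes T' = {}"
      using E(3) 1(4) by auto
    have "w 0 \<in> nodes T1"
      using tracks_root[OF E(1)] .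
    \<comment> \<open>The reversed chain ends at the root of \<open>T1\<close>, which
      \<open>T'\<close> has not reached; hence \<open>T'\<close> still has a waypoint in its
      wavefront and no sample is inserted.\<close>
    then have "?w' m \<notin> nodes T'"
      using disj by auto
    then have "wavefront T' \<noteq> {}"
      using tracks_frontier[OF 1(3) order_refl] by auto
    then have T2: "T2 = T'"
      using proceed(3) by simp
    show ?thesis
      using E(1,5) proceed(1,4) 1 disj tracks_rev_rev[of S r w m T1]
      unfolding T2 by (auto intro!: running_ok.intros)
  qed
qed

text \<open>Excludes executions that are stuck before returning a path, in particular in the
  insertion loop.\<close>

lemma ex_bfmt_step:
  assumes "waypoints F r S w m" "running_ok S r w m s"
  shows "\<exists>t. bfmt_step F r \<xi> s t"
  using assms(2)
proof cases
  case (1 T T' z k)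
  have "z \<in> wavefront T"
    using 1(5) by (simp add: is_arg_min_def)
  then obtain T1 m1 where E: "expand F r z T T' None T1 m1"
    using ex_expand[OF assms(1) 1(2)] by metis
  show ?thesis
  proof (cases m1)
    case (Some x)
    then show ?thesis
      using stop[of F r z T T' T1 x] E 1(1) by blast
  next
    case None
    have "nodes T1 \<inter> nodes T' = {}" "w 0 \<in> nodes T1"
      using expand_tracks(1,3)[OF assms(1) 1(2,5) E] None 1(4) tracks_root[of S r w m T1] by auto
    then have "w (m - m) \<notin> nodes T'"
      by auto
    then have ne: "wavefront T' \<noteq> {}"
      using tracks_frontier[OF 1(3) order_refl] by auto
    moreover have "finite (wavefront T')"
      using tracks_finite[OF assms(1) 1(3)] by simp
    ultimately obtain z' where "is_arg_min (tree_cost T') (\<lambda>y. y \<in> wavefront T') z'"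
      using ex_is_arg_min_if_finite by blast
    then show ?thesis
      using proceed[of F r z T T' T1 \<xi> k T' k z'] E None ne 1(1) by auto
  qed
qed

text \<open>Induction on \<open>pending\<close>. The chain is generalised because each step reverses
  it; the length stays the same.\<close>

lemma execution_returns:
  assumes "waypoints F r S w m" "0 < r"
    and "\<And>i. if \<exists>t. bfmt_step F r \<xi> (s i) t then bfmt_step F r \<xi> (s i) (s (Suc i))
              else s (Suc i) = s i"
    and "running_ok S r w m (s i)"
  shows "\<exists>j l. s j = Returned l \<and> l \<le> chain_length w m + 2 * r"
  using assms(1,4)
proof (induction "pending (s i)" arbitrary: i w rule: less_induct)
  case less
  have step: "bfmt_step F r \<xi> (s i) (s (Suc i))"
    using assms(3)[of i] ex_bfmt_step[OF less.prems] by presburger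
  from running_ok_step[OF less.prems(1) assms(2) less.prems(2) step] show ?case
  proof
    assume "\<exists>l\<le>chain_length w m + 2 * r. s (Suc i) = Returned l"
    then show ?case by auto
  next
    assume *: "running_ok S r (\<lambda>i. w (m - i)) m (s (Suc i)) \<and> pending (s (Suc i)) < pending (s i)"
    show ?case
      using less.hyps[OF _ waypoints_rev[OF less.prems(1)], of "Suc i"] *
        chain_length_rev[of 0 m w] by (simp add: chain_length_def)
  qed
qed

text \<open>No transition leaves a \<open>Returned\<close> state, so the execution is constant from
  there on.\<close>

lemma returned_unique:
  assumes "\<And>i. if \<exists>t. bfmt_step F r \<xi> (s i) t then bfmt_step F r \<xi> (s i) (s (Suc i))
              else s (Suc i) = s i"
    and "s i = Returned l" "s j = Returned l'"
  shows "l = l'"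
proof -
  have const: "s (k + n) = Returned x" if "s k = Returned x" for k n x
  proof (induction n)
    case (Suc n)
    have "\<not> bfmt_step F r \<xi> (s (k + n)) t" for t
      unfolding Suc by (auto elim: bfmt_step.cases)
    then show ?case
      using assms(1)[of "k + n"] Suc by simp
  qed (use that in simp)
  show ?thesis
    using const[OF assms(2), of j] const[OF assms(3), of i] by (simp add: add.commute)
qed

lemma bfmt_cost_le_waypoints:
  assumes "waypoints F r ({xinit, xgoal} \<union> \<xi> ` {..<n}) w m" "0 < r"
    and "w 0 = xinit" "w m = xgoal" "xinit \<noteq> xgoal"
    and "bfmt_cost F xinit xgoal r n \<xi> c"
  shows "c \<le> ereal (chain_length w m + 2 * r)"
proof -
  let ?S = "{xinit, xgoal} \<union> \<xi> ` {..<n}"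
  obtain s where s: "bfmt_execution F xinit xgoal r n \<xi> s"
    and c: "(\<exists>i l. s i = Returned l \<and> c = ereal l) \<or> (\<forall>i l. s i \<noteq> Returned l) \<and> c = \<infinity>"
    using assms(5,6) unfolding bfmt_cost_def by auto
  have step: "if \<exists>t. bfmt_step F r \<xi> (s i) t then bfmt_step F r \<xi> (s i) (s (Suc i))
       else s (Suc i) = s i" for i
    using s by (simp add: bfmt_execution_def)
  have "running_ok ?S r w m (s 0)"
    using s tracks_init[OF assms(1,2)] tracks_init[OF waypoints_rev[OF assms(1)] assms(2)] assms(3-5)
    unfolding bfmt_execution_def bfmt_init_def Let_def
    by (auto intro!: running_ok.intros simp: is_arg_min_def init_tree_def)
  from execution_returns[OF assms(1,2) step this]
  obtain j l where "s j = Returned l" "l \<le> chain_length w m + 2 * r"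
    by auto
  then show ?thesis
    using c returned_unique[of F r \<xi> s, OF step] by (metis ereal_less_eq(3))
qed

subsection \<open>Waypoints along a path\<close>

text \<open>The ball is connected and meets \<open>X\<close> but misses the frontier of
  \<open>X\<close>, which consists of obstacles; so it cannot leave \<open>X\<close>.\<close>

lemma ball_subset_free_space:
  assumes "frontier X \<subseteq> Xobs" "x \<in> delta_interior X Xobs \<delta>" "0 < \<delta>"
  shows "ball x \<delta> \<subseteq> free_space X Xobs"
proof -
  have obs: "ball x \<delta> \<inter> Xobs = {}"
    using assms(2) by (auto simp: delta_interior_def not_less)
  have "x \<in> closure (X - Xobs)"
    using assms(2) by (simp add: delta_interior_def free_space_def)
  then have "ball x \<delta> \<inter> X \<noteq> {}"
    using assms(3) by (force simp: closure_approachable dist_commute)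
  then have "ball x \<delta> \<subseteq> X"
    using connected_Int_frontier[of "ball x \<delta>" X] obs assms(1) by auto
  then show ?thesis
    using obs closure_subset[of "X - Xobs"] by (auto simp: free_space_def)
qed

lemma polyline_length_le_arc_length:
  assumes "sorted ts" "set ts \<subseteq> {0..1}"
  shows "ereal (polyline_length (map \<sigma> ts)) \<le> arc_length \<sigma>"
  unfolding arc_length_def by (rule SUP_upper) (use assms in simp)

lemma dist_le_arc_length: "ereal (dist (\<sigma> 0) (\<sigma> 1)) \<le> arc_length \<sigma>"
  using polyline_length_le_arc_length[of "[0, 1]" \<sigma>] by (simp add: polyline_length_def)

text \<open>Take a longest sequence of points along the path with consecutive distances exactly \<open>s\<close>: by the
  intermediate value theorem the rest of the path stays within \<open>s\<close> of its last point.\<close>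

lemma discretize_path:
  fixes \<sigma> :: "real \<Rightarrow> 'a::metric_space"
  assumes "continuous_on {0..1} \<sigma>" "arc_length \<sigma> \<le> ereal l" "0 < s"
  obtains x m where "x 0 = \<sigma> 0" "x m = \<sigma> 1" "\<And>i. i \<le> m \<Longrightarrow> x i \<in> \<sigma> ` {0..1}"
    and "\<And>i. i < m \<Longrightarrow> dist (x i) (x (Suc i)) \<le> s" "0 < m" "real m * s \<le> l + s"
proof -
  define P where "P k t \<longleftrightarrow> t 0 = (0::real) \<and> (\<forall>i<k. t i \<le> t (Suc i) \<and> dist (\<sigma> (t i)) (\<sigma> (t (Suc i))) = s) \<and>
      t k \<le> 1" for k t
  have mono: "t i \<le> t j" if "P k t" "i \<le> j" "j \<le> k" for k t i j
    using that(2,3)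
  proof (induction j rule: dec_induct)
    case (step j)
    then have "t j \<le> t (Suc j)"
      using that(1) by (simp add: P_def)
    then show ?case
      using step by simp
  qed simp
  have range: "t i \<in> {0..1}" if "P k t" "i \<le> k" for k t i
    using mono[OF that(1), of 0 i] mono[OF that(1), of i k] that by (auto simp: P_def)
  \<comment> \<open>The points span an inscribed polyline of length \<open>k * s\<close>; this
    bounds \<open>k\<close>, so a longest sequence exists.\<close>
  have bound: "real k * s \<le> l" if "P k t" for k t
  proof -
    have "sorted (map t [0..<Suc k])"
      using mono[OF that] by (auto simp: sorted_iff_nth_mono simp del: upt_Suc)
    moreover have "set (map t [0..<Suc k]) \<subseteq> {0..1}"
      using range[OF that] by (auto simp del: upt_Suc)
    ultimately have "ereal (polyline_length (map \<sigma> (map t [0..<Suc k]))) \<le> ereal l"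
      using polyline_length_le_arc_length assms(2) order_trans by blast
    also have "polyline_length (map \<sigma> (map t [0..<Suc k])) = (\<Sum>i<k. s)"
      unfolding polyline_length_def
      by (intro sum.cong) (use that in \<open>auto simp: P_def simp del: upt_Suc\<close>)
    finally show ?thesis by simp
  qed
  have ex0: "P 0 (\<lambda>_. 0)"
    by (simp add: P_def)
  have "k \<le> nat \<lfloor>l / s\<rfloor>" if "\<exists>t. P k t" for k
    using that bound assms(3) by (auto simp: le_nat_floor pos_le_divide_eq)
  then obtain k where k: "\<exists>t. P k t" "\<And>j. \<exists>t. P j t \<Longrightarrow> j \<le> k"
    using GreatestI_ex_nat[of "\<lambda>k. \<exists>t. P k t"] Greatest_le_nat[of "\<lambda>k. \<exists>t. P k t"] ex0 by metis
  from k(1) obtain t where t: "P k t" by auto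
  have tk: "t k \<in> {0..1}"
    using range[OF t] by simp
  have last: "dist (\<sigma> (t k)) (\<sigma> 1) < s"
  proof (rule ccontr)
    assume "\<not> ?thesis"
    moreover have "continuous_on {t k..1} (\<lambda>u. dist (\<sigma> (t k)) (\<sigma> u))"
      using tk by (intro continuous_intros continuous_on_subset[OF assms(1)]) auto
    ultimately obtain v where v: "t k \<le> v" "v \<le> 1" "dist (\<sigma> (t k)) (\<sigma> v) = s"
      using IVT'[of "\<lambda>u. dist (\<sigma> (t k)) (\<sigma> u)" "t k" s 1] tk assms(3) by auto
    then have "P (Suc k) (t(Suc k := v))"
      using t by (auto simp: P_def less_Suc_eq)
    then show False
      using k(2)[of "Suc k"] by auto
  qed
  \<comment> \<open>The end of the path is appended by one shorter step, which accounts for the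
    extra \<open>s\<close> in the bound.\<close>
  define x where "x i = (if i \<le> k then \<sigma> (t i) else \<sigma> 1)" for i
  show thesis
  proof (rule that[of x "Suc k"])
    show "dist (x i) (x (Suc i)) \<le> s" if "i < Suc k" for i
      using that t last by (cases "i = k") (auto simp: x_def P_def)
    show "real (Suc k) * s \<le> l + s"
      using bound[OF t] by (simp add: algebra_simps)
  qed (use t range in \<open>auto simp: x_def P_def\<close>)
qed

text \<open>Each displacement is paid on the two edges at its point, hence the factors 2. Since
  \<open>B\<close> avoids the end points, shifting the index does not increase the sum of the extra
  displacements.\<close>

lemma chain_length_perturb:
  assumes "\<And>i. i < m \<Longrightarrow> dist (x i) (x (Suc i)) \<le> s"
    and "\<And>i. i \<le> m \<Longrightarrow> dist (w i) (x i) \<le> a + (if i \<in> B then b else 0)"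
    and "0 \<le> b" "B \<subseteq> {0<..<m}"
  shows "chain_length w m \<le> real m * (s + 2 * a) + 2 * b * real (card B)"
proof -
  let ?e = "\<lambda>i. if i \<in> B then b else 0"
  have step: "dist (w i) (w (Suc i)) \<le> s + 2 * a + (?e i + ?e (Suc i))" if "i < m" for i
    using assms(1)[OF that] assms(2)[of i] assms(2)[of "Suc i"] that
      dist_triangle[of "w i" "w (Suc i)" "x i"] dist_triangle[of "x i" "w (Suc i)" "x (Suc i)"]
    by (simp add: dist_commute)
  have "(\<Sum>i<m. ?e i) = b * real (card B)"
    using assms(4) by (subst sum.If_cases) (auto simp: Int_absorb1 subset_iff Int_commute intro!: arg_cong[where f = card])
  moreover have "(\<Sum>i<m. ?e (Suc i)) \<le> (\<Sum>i<Suc m. ?e i)"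
    unfolding sum.lessThan_Suc_shift using assms(3) by simp
  moreover have "(\<Sum>i<Suc m. ?e i) = (\<Sum>i<m. ?e i)"
    using assms(4) by auto
  ultimately have e: "(\<Sum>i<m. ?e i + ?e (Suc i)) \<le> 2 * b * real (card B)"
    unfolding sum.distrib by linarith
  have "chain_length w m \<le> (\<Sum>i<m. s + 2 * a + (?e i + ?e (Suc i)))"
    unfolding chain_length_def by (intro sum_mono step) simp
  also have "\<dots> = real m * (s + 2 * a) + (\<Sum>i<m. ?e i + ?e (Suc i))"
    by (simp add: sum.distrib algebra_simps)
  finally show ?thesis
    using e by simp
qed

text \<open>All centers have a sample within \<open>r / 4\<close>, which keeps the chain connected; all but a fraction
  \<open>\<beta>\<close> of them have one within \<open>\<beta> r\<close>, which keeps it short.\<close>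

lemma waypoints_near_centers:
  fixes x :: "nat \<Rightarrow> 'a::euclidean_space"
  assumes "0 < r" "0 < \<beta>" "\<beta> \<le> 1 / 4" "finite P"
    and "\<And>i. i \<le> m \<Longrightarrow> ball (x i) (2 * r) \<subseteq> F"
    and "\<And>i. i < m \<Longrightarrow> dist (x i) (x (Suc i)) \<le> r / 4"
    and "\<And>i. i < m \<Longrightarrow> P \<inter> ball (x i) (r / 4) \<noteq> {}"
    and "real (card {i. i < m \<and> P \<inter> ball (x i) (\<beta> * r) = {}}) \<le> \<beta> * real m"
  obtains w where "waypoints F r ({x 0, x m} \<union> P) w m" "w 0 = x 0" "w m = x m"
    and "chain_length w m \<le> real m * (r / 4) * (1 + 10 * \<beta>)"
proof -
  \<comment> \<open>The end points are tree roots and serve as their own waypoints, so index 0 is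
    not counted as badly approximated.\<close>
  define B where "B = {i. 0 < i \<and> i < m \<and> P \<inter> ball (x i) (\<beta> * r) = {}}"
  have "\<exists>y. (if i = 0 \<or> i = m then y = x i else y \<in> P) \<and> dist y (x i) < r / 4 \<and>
      dist y (x i) \<le> \<beta> * r + (if i \<in> B then r / 4 else 0)" if i: "i \<le> m" for i
  proof (cases "i = 0 \<or> i = m")
    case True
    then show ?thesis
      using assms(1,2) by (intro exI[of _ "x i"]) (auto simp: B_def)
  next
    case False
    have le: "\<beta> * r \<le> r / 4" "0 < \<beta> * r"
      using assms(1-3) by (auto simp: field_simps)
    show ?thesis
    proof (cases "i \<in> B")
      case True
      obtain y where "y \<in> P" "dist y (x i) < r / 4"
        using assms(7)[of i] False i by (auto simp: dist_commute)
      then show ?thesis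
        using False True le by (intro exI[of _ y]) auto
    next
      case nB: False
      obtain y where "y \<in> P" "dist y (x i) < \<beta> * r"
        using nB False i by (auto simp: B_def dist_commute)
      then show ?thesis
        using False nB le by (intro exI[of _ y]) auto
    qed
  qed
  then obtain w where w: "\<And>i. i \<le> m \<Longrightarrow> if i = 0 \<or> i = m then w i = x i else w i \<in> P"
      "\<And>i. i \<le> m \<Longrightarrow> dist (w i) (x i) < r / 4"
      "\<And>i. i \<le> m \<Longrightarrow> dist (w i) (x i) \<le> \<beta> * r + (if i \<in> B then r / 4 else 0)"
    by metis
  \<comment> \<open>Three distances of at most \<open>r / 4\<close> each.\<close>
  have "dist (w i) (w (Suc i)) < r" if "i < m" for i
    using assms(6)[OF that] w(2)[of i] w(2)[of "Suc i"] that assms(1)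
      dist_triangle[of "w i" "w (Suc i)" "x i"] dist_triangle[of "x i" "w (Suc i)" "x (Suc i)"]
    by (simp add: dist_commute)
  moreover have "collision_free F p (w i)" if i: "i \<le> m" and p: "norm (p - w i) < r" for i p
  proof -
    \<comment> \<open>Both points are within \<open>r + r / 4\<close> of the center, and the ball is
      convex, so it contains the segment.\<close>
    have "p \<in> ball (x i) (2 * r)" "w i \<in> ball (x i) (2 * r)"
      using w(2)[OF i] p assms(1) dist_triangle[of p "x i" "w i"]
      by (auto simp: dist_norm[symmetric] dist_commute)
    then show ?thesis
      using assms(5)[OF i] closed_segment_subset[of p "ball (x i) (2 * r)" "w i"]
      by (auto simp: collision_free_def)
  qed
  moreover have "w i \<in> {x 0, x m} \<union> P" if "i \<le> m" for i
    using w(1)[OF that] by (auto split: if_splits)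
  ultimately have wp: "waypoints F r ({x 0, x m} \<union> P) w m"
    using assms(4) by (auto simp: waypoints_def)
  have "card B \<le> card {i. i < m \<and> P \<inter> ball (x i) (\<beta> * r) = {}}"
    by (intro card_mono) (auto simp: B_def)
  then have B: "real (card B) \<le> \<beta> * real m"
    using assms(8) by linarith
  have "chain_length w m \<le> real m * (r / 4 + 2 * (\<beta> * r)) + 2 * (r / 4) * real (card B)"
    using assms(6) w(3) assms(1) by (intro chain_length_perturb[of m x]) (auto simp: B_def)
  also have "\<dots> \<le> real m * (r / 4 + 2 * (\<beta> * r)) + 2 * (r / 4) * (\<beta> * real m)"
    using B assms(1) by (intro add_left_mono mult_left_mono) auto
  \<comment> \<open>In units of \<open>r / 4\<close> per edge, the good waypoints contribute
    \<open>8 * \<beta>\<close> and the bad ones \<open>2 * \<beta>\<close>.\<close>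
  also have "\<dots> = real m * (r / 4) * (1 + 10 * \<beta>)"
    by (simp add: algebra_simps)
  finally show thesis
    using wp w(1)[of 0] w(1)[of m] by (intro that[of w]) auto
qed

text \<open>The outcome of the deterministic part: it remains to bound the probability that one of
  the two sampling hypotheses fails.\<close>

lemma bfmt_cost_le_centers:
  fixes x :: "nat \<Rightarrow> 'a::euclidean_space"
  assumes "0 < r" "0 < \<beta>" "\<beta> \<le> 1 / 4"
    and "\<And>i. i \<le> m \<Longrightarrow> ball (x i) (2 * r) \<subseteq> F"
    and "\<And>i. i < m \<Longrightarrow> dist (x i) (x (Suc i)) \<le> r / 4"
    and "\<And>i. i < m \<Longrightarrow> \<xi> ` {..<n} \<inter> ball (x i) (r / 4) \<noteq> {}"
    and "real (card {i. i < m \<and> \<xi> ` {..<n} \<inter> ball (x i) (\<beta> * r) = {}}) \<le> \<beta> * real m"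
    and "x 0 \<noteq> x m" "bfmt_cost F (x 0) (x m) r n \<xi> c"
  shows "c \<le> ereal (real m * (r / 4) * (1 + 10 * \<beta>) + 2 * r)"
proof -
  obtain w where w: "waypoints F r ({x 0, x m} \<union> \<xi> ` {..<n}) w m" "w 0 = x 0" "w m = x m"
    and len: "chain_length w m \<le> real m * (r / 4) * (1 + 10 * \<beta>)"
    using waypoints_near_centers[OF assms(1-3) finite_imageI[OF finite_lessThan] assms(4-7)]
    by metis
  have "c \<le> ereal (chain_length w m + 2 * r)"
    using bfmt_cost_le_waypoints[OF w(1) assms(1) w(2,3) assms(8,9)] .
  then show ?thesis
    using len by (auto elim: order_trans)
qed

subsection \<open>Sampling\<close>

text \<open>The probability that a uniform sample from \<open>F\<close> hits a given ball of radius
  \<open>\<rho>\<close> inside \<open>F\<close>.\<close>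

definition ball_fraction :: "'a::euclidean_space set \<Rightarrow> real \<Rightarrow> real" where
  "ball_fraction F \<rho> = measure lborel (cball (0::'a) 1) * \<rho> ^ DIM('a) / measure lborel F"

text \<open>The \<open>n\<close> misses are independent, and \<open>1 - p\<close> is at most
  \<open>exp (- p)\<close>.\<close>

lemma (in prob_space) prob_no_sample_in_ball:
  fixes \<zeta> :: "nat \<Rightarrow> 'a \<Rightarrow> 'b::euclidean_space"
  assumes "indep_vars (\<lambda>_. borel) \<zeta> UNIV" "\<And>i. distr M borel (\<zeta> i) = uniform_measure lborel F"
    and "0 < emeasure lborel F" "emeasure lborel F < \<infinity>" "F \<in> sets borel"
    and "ball x \<rho> \<subseteq> F" "0 < \<rho>"
  shows "{\<omega> \<in> space M. (\<lambda>i. \<zeta> i \<omega>) ` {..<n} \<inter> ball x \<rho> = {}} \<in> events"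
    and "prob {\<omega> \<in> space M. (\<lambda>i. \<zeta> i \<omega>) ` {..<n} \<inter> ball x \<rho> = {}} \<le> exp (- real n * ball_fraction F \<rho>)"
proof -
  let ?E = "{\<omega> \<in> space M. (\<lambda>i. \<zeta> i \<omega>) ` {..<n} \<inter> ball x \<rho> = {}}"
  let ?H = "\<lambda>i. \<zeta> i -` (- ball x \<rho>) \<inter> space M"
  have rv: "\<zeta> i \<in> borel_measurable M" for i
    using assms(1) by (auto simp: indep_vars_def)
  have E: "?E = space M - (\<Union>i<n. \<zeta> i -` ball x \<rho> \<inter> space M)"
    by auto
  show "?E \<in> events"
    unfolding E using rv by (intro sets.Diff sets.finite_UN measurable_sets) auto
  have hit: "prob (\<zeta> i -` ball x \<rho> \<inter> space M) = ball_fraction F \<rho>" for i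
  proof -
    have "prob (\<zeta> i -` ball x \<rho> \<inter> space M) = measure (distr M borel (\<zeta> i)) (ball x \<rho>)"
      by (rule measure_distr[symmetric]) (use rv in auto)
    also have "\<dots> = measure lborel (F \<inter> ball x \<rho>) / measure lborel F"
      unfolding assms(2) using assms(3-5) by (intro measure_uniform_measure) auto
    also have "F \<inter> ball x \<rho> = ball x \<rho>"
      using assms(6) by auto
    finally show ?thesis
      using assms(7) by (simp add: ball_fraction_def content_ball content_cball)
  qed
  have miss: "prob (?H i) = 1 - ball_fraction F \<rho>" for i
  proof -
    have "?H i = space M - (\<zeta> i -` ball x \<rho> \<inter> space M)"
      by auto
    then show ?thesis
      using prob_compl[of "\<zeta> i -` ball x \<rho> \<inter> space M"] rv[of i] hit[of i]
      by (simp add: measurable_sets)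
  qed
  have "prob ?E = (1 - ball_fraction F \<rho>) ^ n"
  \<comment> \<open>An intersection over no indices would be \<open>UNIV\<close> instead of the
    sample space.\<close>
  proof (cases "n = 0")
    case True
    then show ?thesis by (simp add: prob_space)
  next
    case False
    then have "?E = (\<Inter>i\<in>{..<n}. ?H i)"
      by auto
    also have "prob \<dots> = (\<Prod>i<n. prob (?H i))"
      by (rule indep_varsD[OF assms(1)]) (use False in auto)
    finally show ?thesis
      by (simp add: miss)
  qed
  also have "\<dots> \<le> exp (- ball_fraction F \<rho>) ^ n"
    using miss[of 0] measure_nonneg[of M "?H 0"] exp_ge_add_one_self[of "- ball_fraction F \<rho>"]
    by (intro power_mono) auto
  also have "\<dots> = exp (- real n * ball_fraction F \<rho>)"
    by (simp add: exp_of_nat_mult[symmetric])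
  finally show "prob ?E \<le> exp (- real n * ball_fraction F \<rho>)" .
qed

text \<open>Markov's inequality for the number of events that occur. By linearity of expectation it
  covers dependent events, such as misses of overlapping balls.\<close>

lemma (in prob_space) prob_card_ge:
  assumes "\<And>i. i < (m::nat) \<Longrightarrow> E i \<in> events" "\<And>i. i < m \<Longrightarrow> prob (E i) \<le> p"
    and "0 < \<beta>" "0 < m"
  shows "{\<omega> \<in> space M. \<beta> * real m \<le> real (card {i. i < m \<and> \<omega> \<in> E i})} \<in> events"
    and "prob {\<omega> \<in> space M. \<beta> * real m \<le> real (card {i. i < m \<and> \<omega> \<in> E i})} \<le> p / \<beta>"
proof -
  define u where "u \<omega> = (\<Sum>i<m. indicator (E i) \<omega> :: real)" for \<omega>
  have u: "real (card {i. i < m \<and> \<omega> \<in> E i}) = u \<omega>" for \<omega>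
  proof -
    have "{i. i < m \<and> \<omega> \<in> E i} = {..<m} \<inter> {i. \<omega> \<in> E i}"
      by auto
    then show ?thesis
      by (simp add: u_def indicator_def)
  qed
  have int: "integrable M u"
    unfolding u_def using assms(1) by (intro Bochner_Integration.integrable_sum) (auto simp: emeasure_eq_measure)
  show "{\<omega> \<in> space M. \<beta> * real m \<le> real (card {i. i < m \<and> \<omega> \<in> E i})} \<in> events"
    unfolding u using borel_measurable_integrable[OF int] by measurable
  have "prob {\<omega> \<in> space M. \<beta> * real m \<le> u \<omega>} \<le> expectation u / (\<beta> * real m)"
    by (rule integral_Markov_inequality_measure[OF int, where A = "{}"])
      (use assms(3,4) in \<open>auto simp: u_def sum_nonneg\<close>)
  also have "expectation u = (\<Sum>i<m. prob (E i))"
    unfolding u_def using assms(1)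
    by (subst Bochner_Integration.integral_sum) (auto simp: emeasure_eq_measure Int_absorb1 sets.sets_into_space Int_commute)
  also have "(\<Sum>i<m. prob (E i)) / (\<beta> * real m) \<le> (\<Sum>i<m. p) / (\<beta> * real m)"
    using assms by (intro divide_right_mono sum_mono) auto
  also have "\<dots> = p / \<beta>"
    using assms(3,4) by simp
  finally show "prob {\<omega> \<in> space M. \<beta> * real m \<le> real (card {i. i < m \<and> \<omega> \<in> E i})} \<le> p / \<beta>"
    unfolding u .
qed

section \<open>Asymptotics of the connection radius\<close>

text \<open>The volumes in the radius cancel. At \<open>\<rho> = 1 / 4\<close> the factor 4 cancels
  as well, and a ball is missed with probability at most \<open>n powr (- (1 + \<eta>) / d)\<close>
  in dimension \<open>d\<close>.\<close>

lemma ball_fraction_bfmt_radius: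
  fixes F :: "'a::euclidean_space set"
  assumes "0 < measure lborel F" "0 \<le> \<eta>" "0 \<le> \<rho>" "1 < n"
  shows "real n * ball_fraction F (\<rho> * bfmt_radius F \<eta> n) =
     (4 * \<rho>) ^ DIM('a) * (1 + \<eta>) / real DIM('a) * ln (real n)"
proof -
  let ?d = "real DIM('a)"
  have d: "(x powr (1 / ?d)) ^ DIM('a) = x" if "0 < x" for x :: real
    using that by (simp add: powr_realpow[symmetric] powr_powr)
  have \<zeta>: "0 < measure lborel (cball (0::'a) 1)"
    by (simp add: content_cball)
  have r: "bfmt_radius F \<eta> n ^ DIM('a) = 4 ^ DIM('a) * (1 + \<eta>) * (1 / ?d) *
      (measure lborel F / measure lborel (cball (0::'a) 1)) * (ln (real n) / real n)"
    unfolding bfmt_radius_def Let_def power_mult_distrib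
    using assms \<zeta> by (simp add: d)
  show ?thesis
    unfolding ball_fraction_def power_mult_distrib r
    using assms \<zeta> by (simp add: field_simps)
qed

lemma bfmt_radius_eq:
  fixes F :: "'a::euclidean_space set"
  assumes "0 < measure lborel F" "0 \<le> \<eta>"
  shows "\<exists>K>0. \<forall>n. bfmt_radius F \<eta> n = K * (ln (real n) / real n) powr (1 / real DIM('a))"
proof -
  have "0 < measure lborel (cball (0::'a) 1)"
    by (simp add: content_cball)
  then have "0 < 4 * (1 + \<eta>) powr (1 / real DIM('a)) * (1 / real DIM('a)) powr (1 / real DIM('a)) *
      (measure lborel F / measure lborel (cball (0::'a) 1)) powr (1 / real DIM('a))"
    using assms by simp
  then show ?thesis
    unfolding bfmt_radius_def Let_def by blast
qed

lemma bfmt_radius_tendsto_0: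
  fixes F :: "'a::euclidean_space set"
  assumes "0 < measure lborel F" "0 \<le> \<eta>"
  shows "bfmt_radius F \<eta> \<longlonglongrightarrow> 0"
proof -
  obtain K where K: "0 < K"
    "\<And>n. bfmt_radius F \<eta> n = K * (ln (real n) / real n) powr (1 / real DIM('a))"
    using bfmt_radius_eq[OF assms] by auto
  have "0 < 1 / real DIM('a)"
    by simp
  then have "(\<lambda>n. K * (ln (real n) / real n) powr (1 / real DIM('a))) \<longlonglongrightarrow> 0"
    using K(1) by real_asymp
  then show ?thesis
    by (simp add: K(2)[abs_def])
qed

text \<open>There are about \<open>(n / ln n) powr (1 / d)\<close> centers, each missed with
  probability at most \<open>n powr (- 1 / d)\<close>. The logarithm that is left over drives the
  product to 0, even for \<open>\<eta> = 0\<close>.\<close>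

lemma union_bound_tendsto_0:
  fixes F :: "'a::euclidean_space set"
  assumes "0 < measure lborel F" "0 \<le> \<eta>" "0 \<le> l"
  shows "(\<lambda>n. (4 * l / bfmt_radius F \<eta> n + 1) * exp (- ln (real n) / real DIM('a))) \<longlonglongrightarrow> 0"
proof -
  obtain K where K: "0 < K"
    "\<And>n. bfmt_radius F \<eta> n = K * (ln (real n) / real n) powr (1 / real DIM('a))"
    using bfmt_radius_eq[OF assms(1,2)] by auto
  define a where "a = 1 / real DIM('a)"
  have a: "0 < a"
    by (simp add: a_def)
  have "(\<lambda>n. (4 * l / K) * (1 / ln (real n)) powr a + exp (- ln (real n) * a)) \<longlonglongrightarrow> 0"
    using a by real_asymp
  moreover have "\<forall>\<^sub>F n in sequentially.
      (4 * l / K) * (1 / ln (real n)) powr a + exp (- ln (real n) * a) =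
      (4 * l / bfmt_radius F \<eta> n + 1) * exp (- ln (real n) / real DIM('a))"
    using eventually_gt_at_top[of 1]
  proof eventually_elim
    case (elim n)
    have e: "exp (- ln (real n) * a) = 1 / real n powr a"
      using elim by (simp add: powr_def exp_minus field_simps)
    have d: "- ln (real n) / real DIM('a) = - ln (real n) * a"
      by (simp add: a_def)
    have r: "bfmt_radius F \<eta> n = K * (ln (real n) powr a / real n powr a)"
      using elim by (simp add: K(2) a_def powr_divide)
    have p: "(1 / ln (real n)) powr a = 1 / ln (real n) powr a"
      using elim by (simp add: powr_divide)
    have "0 < ln (real n) powr a" "0 < real n powr a"
      using elim by auto
    then show ?case
      unfolding d e r p using K(1) by (simp add: field_simps)
  qed
  ultimately show ?thesis
    by (rule Lim_transform_eventually)
qed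

section \<open>The failure probability for a fixed number of samples\<close>

lemma (in prob_space) prob_bfmt_cost_gt:
  fixes \<sigma> :: "real \<Rightarrow> 'b::euclidean_space" and F :: "'b set"
    and \<zeta> :: "nat \<Rightarrow> 'a \<Rightarrow> 'b" and c :: "'a \<Rightarrow> ereal"
  assumes "indep_vars (\<lambda>_. borel) \<zeta> UNIV" "\<And>i. distr M borel (\<zeta> i) = uniform_measure lborel F"
    and "0 < emeasure lborel F" "emeasure lborel F < \<infinity>" "F \<in> sets borel"
    and "continuous_on {0..1} \<sigma>" "arc_length \<sigma> \<le> ereal l" "\<sigma> 0 \<noteq> \<sigma> 1"
    and "\<And>y. y \<in> \<sigma> ` {0..1} \<Longrightarrow> ball y (2 * r) \<subseteq> F"
    and "0 < r" "0 < \<beta>" "\<beta> \<le> 1 / 4"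
    and "\<And>\<omega>. \<omega> \<in> space M \<Longrightarrow> bfmt_cost F (\<sigma> 0) (\<sigma> 1) r n (\<lambda>i. \<zeta> i \<omega>) (c \<omega>)"
  shows "prob {\<omega> \<in> space M. c \<omega> > ereal ((l + r / 4) * (1 + 10 * \<beta>) + 2 * r)} \<le>
     (4 * l / r + 1) * exp (- real n * ball_fraction F (1 / 4 * r)) +
     exp (- real n * ball_fraction F (\<beta> * r)) / \<beta>"
proof -
  obtain x m where x: "x 0 = \<sigma> 0" "x m = \<sigma> 1" "\<And>i. i \<le> m \<Longrightarrow> x i \<in> \<sigma> ` {0..1}"
      "\<And>i. i < m \<Longrightarrow> dist (x i) (x (Suc i)) \<le> r / 4" "0 < m" "real m * (r / 4) \<le> l + r / 4"
    using discretize_path[OF assms(6,7), of "r / 4"] assms(10) by (metis zero_less_divide_iff zero_less_numeral)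
  define E where "E \<rho> i = {\<omega> \<in> space M. (\<lambda>j. \<zeta> j \<omega>) ` {..<n} \<inter> ball (x i) (\<rho> * r) = {}}" for \<rho> i
  \<comment> \<open>The two failure events: \<open>A\<close>, bounded by a union bound, breaks the
    connectivity of the chain; \<open>B\<close>, bounded by Markov's inequality, makes it too
    long.\<close>
  define A where "A = (\<Union>i<m. E (1 / 4) i)"
  define B where "B = {\<omega> \<in> space M. \<beta> * real m \<le> real (card {i. i < m \<and> \<omega> \<in> E \<beta> i})}"
  have E: "E \<rho> i \<in> events" "prob (E \<rho> i) \<le> exp (- real n * ball_fraction F (\<rho> * r))"
    if "i < m" "0 < \<rho>" "\<rho> \<le> 1 / 4" for \<rho> i
  proof -
    have "\<rho> * r \<le> 2 * r"
      using that assms(10) by simp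
    then have "ball (x i) (\<rho> * r) \<subseteq> F"
      using assms(9)[OF x(3)[of i]] that subset_ball[of "\<rho> * r" "2 * r" "x i"] by auto
    then show "E \<rho> i \<in> events" "prob (E \<rho> i) \<le> exp (- real n * ball_fraction F (\<rho> * r))"
      using prob_no_sample_in_ball[OF assms(1-5), of "x i" "\<rho> * r" n] that assms(10)
      by (simp_all add: E_def)
  qed
  have A: "A \<in> events"
    unfolding A_def using E(1) by auto
  have "prob A \<le> (\<Sum>i<m. prob (E (1 / 4) i))"
    unfolding A_def using E(1) by (intro finite_measure_subadditive_finite) auto
  also have "\<dots> \<le> (\<Sum>i<m. exp (- real n * ball_fraction F (1 / 4 * r)))"
    using E(2)[of _ "1 / 4"] by (intro sum_mono) simp
  also have "\<dots> = real m * exp (- real n * ball_fraction F (1 / 4 * r))"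
    by simp
  also have "\<dots> \<le> (4 * l / r + 1) * exp (- real n * ball_fraction F (1 / 4 * r))"
    using x(6) assms(10) by (intro mult_right_mono) (auto simp: field_simps)
  finally have prob_A: "prob A \<le> (4 * l / r + 1) * exp (- real n * ball_fraction F (1 / 4 * r))" .
  have B: "B \<in> events" "prob B \<le> exp (- real n * ball_fraction F (\<beta> * r)) / \<beta>"
    unfolding B_def using prob_card_ge[of m "E \<beta>"] E assms(11,12) x(5) by auto
  have "c \<omega> \<le> ereal ((l + r / 4) * (1 + 10 * \<beta>) + 2 * r)" if "\<omega> \<in> space M - (A \<union> B)" for \<omega>
  proof -
    have "(\<lambda>j. \<zeta> j \<omega>) ` {..<n} \<inter> ball (x i) (r / 4) \<noteq> {}" if "i < m" for i
      using that \<open>\<omega> \<in> space M - (A \<union> B)\<close> unfolding A_def E_def by force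
    moreover have "real (card {i. i < m \<and> (\<lambda>j. \<zeta> j \<omega>) ` {..<n} \<inter> ball (x i) (\<beta> * r) = {}}) \<le>
        \<beta> * real m"
      using that unfolding B_def E_def by auto
    ultimately have "c \<omega> \<le> ereal (real m * (r / 4) * (1 + 10 * \<beta>) + 2 * r)"
      using x assms(8-13) that
      by (intro bfmt_cost_le_centers[where F = F and \<xi> = "\<lambda>j. \<zeta> j \<omega>" and n = n]) auto
    also have "\<dots> \<le> ereal ((l + r / 4) * (1 + 10 * \<beta>) + 2 * r)"
      using x(6) assms(11) by (simp add: mult_right_mono del: times_divide_eq_right)
    finally show ?thesis .
  qed
  then have "{\<omega> \<in> space M. c \<omega> > ereal ((l + r / 4) * (1 + 10 * \<beta>) + 2 * r)} \<subseteq> A \<union> B"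
    by (force simp: not_less)
  then have "prob {\<omega> \<in> space M. c \<omega> > ereal ((l + r / 4) * (1 + 10 * \<beta>) + 2 * r)} \<le> prob (A \<union> B)"
    using A B(1) by (intro finite_measure_mono) auto
  also have "\<dots> \<le> prob A + prob B"
    using A B(1) by (rule measure_Un_le)
  finally show ?thesis
    using prob_A B(2) by linarith
qed

section \<open>Convergence in probability\<close>

theorem theorem2:
  fixes X Xobs :: "'a::euclidean_space set" and xinit xgoal :: 'a
    and \<sigma>opt :: "real \<Rightarrow> 'a" and \<delta> \<eta> \<epsilon> :: real
    and M :: "'w measure" and \<xi> :: "nat \<Rightarrow> nat \<Rightarrow> 'w \<Rightarrow> 'a" and c :: "nat \<Rightarrow> 'w \<Rightarrow> ereal"
  defines "F \<equiv> free_space X Xobs"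
  assumes "open (X - Xobs)" and "frontier X \<subseteq> Xobs"
    and "0 < emeasure lborel F" and "emeasure lborel F < \<infinity>"
    and "\<delta> > 0" and "robustly_feasible X Xobs xinit xgoal \<delta>"
    and "optimal_path X Xobs xinit xgoal \<sigma>opt"
    and "\<eta> \<ge> 0"
    and "prob_space M"
    and "\<And>n. prob_space.indep_vars M (\<lambda>_. borel) (\<xi> n) UNIV"
    and "\<And>n i. distr M borel (\<xi> n i) = uniform_measure lborel F"
    and "\<And>n. c n \<in> borel_measurable M"
    and "\<And>n \<omega>. \<omega> \<in> space M \<Longrightarrow>
           bfmt_cost F xinit xgoal (bfmt_radius F \<eta> n) n (\<lambda>i. \<xi> n i \<omega>) (c n \<omega>)"
    and "\<epsilon> > 0"
  shows "(\<lambda>n. measure M {\<omega> \<in> space M. c n \<omega> > ereal (1 + \<epsilon>) * arc_length \<sigma>opt}) \<longlonglongrightarrow> 0"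
proof -
  interpret prob_space M by fact
  have opt: "\<sigma>opt 0 = xinit" "\<sigma>opt 1 = xgoal" "arc_length \<sigma>opt < \<infinity>"
    using assms(8) by (auto simp: optimal_path_def feasible_path_def collision_free_path_def is_path_def)
  define L where "L = real_of_ereal (arc_length \<sigma>opt)"
  have ge: "ereal (dist xinit xgoal) \<le> arc_length \<sigma>opt"
    using dist_le_arc_length[of \<sigma>opt] opt by simp
  then have L: "arc_length \<sigma>opt = ereal L"
    using opt(3) unfolding L_def by (cases "arc_length \<sigma>opt") auto
  show ?thesis
  proof (cases "xinit = xgoal")
    case True
    have "c n \<omega> = 0" if "\<omega> \<in> space M" for n \<omega>
      using assms(14)[OF that, of n] True by (simp add: bfmt_cost_def)
    moreover have "0 \<le> (1 + \<epsilon>) * L"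
      using ge L True assms(15) by simp
    ultimately have "{\<omega> \<in> space M. c n \<omega> > ereal (1 + \<epsilon>) * arc_length \<sigma>opt} = {}" for n
      by (auto simp: L)
    then show ?thesis
      by (simp only: measure_empty tendsto_const)
  next
    case False
    have L_pos: "0 < L"
      using ge L False less_le_trans[of 0 "dist xinit xgoal" L] by simp
    have F: "F \<in> sets borel"
      by (simp add: F_def free_space_def)
    have \<mu>: "0 < measure lborel F"
      using assms(4,5) by (simp add: measure_def enn2real_positive_iff)

    obtain \<sigma>' \<delta>s \<sigma>s where rf: "optimal_path X Xobs xinit xgoal \<sigma>'"
        "\<And>k. k \<ge> 1 \<Longrightarrow> 0 < \<delta>s k" "(\<lambda>k. arc_length (\<sigma>s k)) \<longlonglongrightarrow> arc_length \<sigma>'"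
        "\<And>k. k \<ge> 1 \<Longrightarrow> feasible_path X Xobs xinit xgoal (\<sigma>s k) \<and>
           strong_clearance X Xobs (\<delta>s k) (\<sigma>s k)"
      using assms(7) unfolding robustly_feasible_def by blast
    \<comment> \<open>Robust feasibility supplies an optimal path of its own, of the same length as
      the given one.\<close>
    have "arc_length \<sigma>' = ereal L"
      using rf(1) assms(8) L by (metis optimal_path_def order_antisym)
    moreover have "L < (1 + \<epsilon> / 2) * L"
      using L_pos assms(15) by simp
    ultimately have "\<forall>\<^sub>F k in sequentially. arc_length (\<sigma>s k) < ereal ((1 + \<epsilon> / 2) * L)"
      using rf(3) by (intro order_tendstoD(2)) auto
    then have "\<forall>\<^sub>F k in sequentially. arc_length (\<sigma>s k) < ereal ((1 + \<epsilon> / 2) * L) \<and> k \<ge> 1"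
      using eventually_ge_at_top by (rule eventually_conj)
    then obtain k where k: "arc_length (\<sigma>s k) < ereal ((1 + \<epsilon> / 2) * L)" "k \<ge> 1"
      using eventually_happens'[OF sequentially_bot] by blast
    \<comment> \<open>Half of the tolerance goes to the choice of one approximating path, which
      stays fixed while \<open>n\<close> grows.\<close>
    define l where "l = (1 + \<epsilon> / 2) * L"
    have l: "arc_length (\<sigma>s k) \<le> ereal l" "0 < l"
      using k L_pos assms(15) by (auto simp: l_def)
    have \<sigma>: "continuous_on {0..1} (\<sigma>s k)" "\<sigma>s k 0 = xinit" "\<sigma>s k 1 = xgoal"
        "\<sigma>s k ` {0..1} \<subseteq> delta_interior X Xobs (\<delta>s k)"
      using rf(4)[OF k(2)]
      by (auto simp: feasible_path_def collision_free_path_def is_path_def strong_clearance_def)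
    have clear: "ball y (\<delta>s k) \<subseteq> F" if "y \<in> \<sigma>s k ` {0..1}" for y
      using ball_subset_free_space[OF assms(3) _ rf(2)[OF k(2)]] \<sigma>(4) that by (auto simp: F_def)

    \<comment> \<open>Chosen so that \<open>(1 + \<epsilon> / 2) * (1 + 10 * \<beta>)\<close> is at
      most \<open>1 + 3 * \<epsilon> / 4\<close>; the last quarter absorbs the terms that vanish
      with the radius.\<close>
    define \<beta> where "\<beta> = min (1 / 4) (\<epsilon> / (20 * (2 + \<epsilon>)))"
    have \<beta>: "0 < \<beta>" "\<beta> \<le> 1 / 4" "\<beta> \<le> \<epsilon> / (20 * (2 + \<epsilon>))"
      using assms(15) by (auto simp: \<beta>_def)
    have "l * (1 + 10 * \<beta>) \<le> l * (1 + 10 * (\<epsilon> / (20 * (2 + \<epsilon>))))"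
      using \<beta>(3) l(2) by simp
    also have "\<dots> = (1 + \<epsilon> * 3 / 4) * L"
      using assms(15) by (simp add: l_def field_simps)
    also have "\<dots> < (1 + \<epsilon>) * L"
      using L_pos assms(15) by simp
    finally have gap: "l * (1 + 10 * \<beta>) < (1 + \<epsilon>) * L" .

    let ?r = "bfmt_radius F \<eta>"
    have r0: "?r \<longlonglongrightarrow> 0"
      using bfmt_radius_tendsto_0[OF \<mu> assms(9)] .
    have "(\<lambda>n. (l + ?r n / 4) * (1 + 10 * \<beta>) + 2 * ?r n) \<longlonglongrightarrow> (l + 0 / 4) * (1 + 10 * \<beta>) + 2 * 0"
      by (intro tendsto_intros r0) auto
    then have ev_cost: "\<forall>\<^sub>F n in sequentially.
        (l + ?r n / 4) * (1 + 10 * \<beta>) + 2 * ?r n < (1 + \<epsilon>) * L"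
      using gap by (intro order_tendstoD(2)) auto
    \<comment> \<open>The clearance of the fixed path eventually exceeds twice the radius.\<close>
    have ev_r: "\<forall>\<^sub>F n in sequentially. ?r n < \<delta>s k / 2"
      using rf(2)[OF k(2)] by (intro order_tendstoD(2)[OF r0]) auto

    \<comment> \<open>The Markov term is \<open>n powr (- \<kappa>) / \<beta>\<close>. It carries no
      factor for the number of centers, so any positive exponent will do, however small
      \<open>\<beta>\<close> is.\<close>
    define \<kappa> where "\<kappa> = (4 * \<beta>) ^ DIM('a) * (1 + \<eta>) / real DIM('a)"
    have \<kappa>: "0 < \<kappa>"
      using \<beta> assms(9) by (simp add: \<kappa>_def)
    let ?bound = "\<lambda>n. (4 * l / ?r n + 1) * exp (- ln (real n) / real DIM('a)) +
        exp (- (\<kappa> * ln (real n))) / \<beta>"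
    have "(\<lambda>n. exp (- (\<kappa> * ln (real n))) / \<beta>) \<longlonglongrightarrow> 0"
      using \<kappa> \<beta>(1) by real_asymp
    then have "?bound \<longlonglongrightarrow> 0 + 0"
      using l(2) by (intro tendsto_add union_bound_tendsto_0[OF \<mu> assms(9)]) auto
    then have bound: "?bound \<longlonglongrightarrow> 0"
      by simp

    have "\<forall>\<^sub>F n in sequentially.
        prob {\<omega> \<in> space M. c n \<omega> > ereal (1 + \<epsilon>) * arc_length \<sigma>opt} \<le> ?bound n"
      using ev_cost ev_r eventually_gt_at_top[of 1]
    proof eventually_elim
      case (elim n)
      have r: "0 < ?r n"
        using bfmt_radius_eq[OF \<mu> assms(9)] elim(3) by (auto simp: zero_less_mult_iff)
      have "ball y (2 * ?r n) \<subseteq> F" if "y \<in> \<sigma>s k ` {0..1}" for y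
        using clear[OF that] subset_ball[of "2 * ?r n" "\<delta>s k" y] elim(2) by auto
      then have main: "prob {\<omega> \<in> space M. c n \<omega> > ereal ((l + ?r n / 4) * (1 + 10 * \<beta>) + 2 * ?r n)} \<le>
          (4 * l / ?r n + 1) * exp (- real n * ball_fraction F (1 / 4 * ?r n)) +
          exp (- real n * ball_fraction F (\<beta> * ?r n)) / \<beta>"
        using assms(4,5,11,12,14) F \<sigma>(1-3) l(1) False r \<beta>(1,2)
        by (intro prob_bfmt_cost_gt) auto
      have "ln (real n) / real DIM('a) \<le> (1 + \<eta>) * ln (real n) / real DIM('a)"
        using assms(9) elim(3) by (intro divide_right_mono) (auto simp: mult_le_cancel_right1)
      also have "\<dots> = real n * ball_fraction F (1 / 4 * ?r n)"
        using ball_fraction_bfmt_radius[OF \<mu> assms(9), of "1 / 4" n] elim(3) by simp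
      finally have "exp (- real n * ball_fraction F (1 / 4 * ?r n)) \<le> exp (- ln (real n) / real DIM('a))"
        by simp
      then have "(4 * l / ?r n + 1) * exp (- real n * ball_fraction F (1 / 4 * ?r n)) \<le>
          (4 * l / ?r n + 1) * exp (- ln (real n) / real DIM('a))"
        using l(2) r by (intro mult_left_mono) auto
      moreover have "real n * ball_fraction F (\<beta> * ?r n) = \<kappa> * ln (real n)"
        using ball_fraction_bfmt_radius[OF \<mu> assms(9), of \<beta> n] elim(3) \<beta>(1) by (simp add: \<kappa>_def)
      moreover have "prob {\<omega> \<in> space M. c n \<omega> > ereal (1 + \<epsilon>) * arc_length \<sigma>opt} \<le>
          prob {\<omega> \<in> space M. c n \<omega> > ereal ((l + ?r n / 4) * (1 + 10 * \<beta>) + 2 * ?r n)}"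
      proof (rule finite_measure_mono)
        have "ereal ((l + ?r n / 4) * (1 + 10 * \<beta>) + 2 * ?r n) \<le> ereal (1 + \<epsilon>) * arc_length \<sigma>opt"
          using elim(1) by (simp add: L)
        then show "{\<omega> \<in> space M. c n \<omega> > ereal (1 + \<epsilon>) * arc_length \<sigma>opt} \<subseteq>
            {\<omega> \<in> space M. c n \<omega> > ereal ((l + ?r n / 4) * (1 + 10 * \<beta>) + 2 * ?r n)}"
          using le_less_trans by blast
        show "{\<omega> \<in> space M. c n \<omega> > ereal ((l + ?r n / 4) * (1 + 10 * \<beta>) + 2 * ?r n)} \<in> events"
          using assms(13)[of n] by measurable
      qed
      ultimately show ?case
        using main by simp
    qed
    then show ?thesis
      by (intro tendsto_sandwich[OF _ _ tendsto_const bound]) auto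
  qed
qed

end
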